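(* Let $G$ be a group of finite order $k$, let $(\Gamma,\Psi)$ be a connected $G$-gain graph, and let $L(\Gamma,\Psi)$ be its cover graph. The following are equivalent: (i) $(\Gamma,\Psi)$ is balanced; (ii) $\sigma(L(\Gamma,\Psi))=k\,\sigma(\Gamma)$, i.e. the adjacency spectrum of $L(\Gamma,\Psi)$ consists of $k$ copies of the adjacency spectrum of $\Gamma$; (iii) $\lambda_1(L(\Gamma,\Psi))=\lambda_1(\Gamma)$, and this is an eigenvalue of the adjacency matrix of $L(\Gamma,\Psi)$ with multiplicity $k$; (iv) $L(\Gamma,\Psi)=k\,\Gamma$, i.e. $L(\Gamma,\Psi)$ is isomorphic to the disjoint union of $k$ copies of $\Gamma$.
   Context: $\Gamma=(V_\Gamma,E_\Gamma)$ is a finite simple graph (no loops, no multiple edges) whose edges are regarded as ordered pairs, with $(v,u)\in E_\Gamma$ if and only if $(u,v)\in E_\Gamma$; write $u\sim v$ if $(u,v)\in E_\Gamma$. A $G$-gain function is a map $\Psi\colon E_\Gamma\to G$ with $\Psi(u,v)=\Psi(v,u)^{-1}$; the pair $(\Gamma,\Psi)$ is a $G$-gain graph, connected if $\Gamma$ is. A walk is a sequence of vertices $w_0,\dots,w_h$ with $w_i\sim w_{i+1}$; its gain is $\Psi(w_0,w_1)\cdots\Psi(w_{h-1},w_h)$; it is closed if $w_0=w_h$. $(\Gamma,\Psi)$ is balanced if every closed walk has gain $1_G$, the identity of $G$. The cover graph $L(\Gamma,\Psi)$ is the non-oriented graph with vertex set $V_\Gamma\times G$ such that, for $u,v\in V_\Gamma$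 and $g,h\in G$, $(u,g)\sim(v,h)$ if and only if $(u,v)\in E_\Gamma$ and $h=\Psi(u,v)^{-1}g$. For a graph, $\sigma$ denotes the spectrum of its $0/1$ adjacency matrix (as a multiset) and $\lambda_1$ the largest eigenvalue of that matrix. *)

theory Defs
  imports
    "Graph_Theory.Graph_Theory"
    "Jordan_Normal_Form.Spectral_Radius"
    "HOL-Algebra.Coset"
begin

text \<open>
  Finite simple graphs are \<^locale>\<open>pair_graph\<close>: a finite vertex set together with a symmetric,
  irreflexive set of ordered pairs.  The predicate \<^const>\<open>Digraph_Component.connected\<close> includes
  that the vertex set is nonempty.
\<close>

section \<open>Gain graphs\<close>

definition gain_function ::
  "('g, 'm) monoid_scheme \<Rightarrow> 'v pair_pre_digraph \<Rightarrow> ('v \<times> 'v \<Rightarrow> 'g) \<Rightarrow> bool" where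
  "gain_function G \<Gamma> \<Psi> \<longleftrightarrow>
     (\<forall>(u, v) \<in> parcs \<Gamma>. \<Psi> (u, v) \<in> carrier G \<and> \<Psi> (u, v) = inv\<^bsub>G\<^esub> \<Psi> (v, u))"

text \<open>A walk is given by its list of vertices; the one-vertex walk is closed and has gain \<open>\<one>\<close>.\<close>

definition walk_gain ::
  "('g, 'm) monoid_scheme \<Rightarrow> ('v \<times> 'v \<Rightarrow> 'g) \<Rightarrow> 'v list \<Rightarrow> 'g" where
  "walk_gain G \<Psi> p = foldr (\<otimes>\<^bsub>G\<^esub>) (map \<Psi> (vwalk_arcs p)) \<one>\<^bsub>G\<^esub>"

definition balanced ::
  "('g, 'm) monoid_scheme \<Rightarrow> 'v pair_pre_digraph \<Rightarrow> ('v \<times> 'v \<Rightarrow> 'g) \<Rightarrow> bool" where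
  "balanced G \<Gamma> \<Psi> \<longleftrightarrow>
     (\<forall>p. vwalk p (with_proj \<Gamma>) \<and> hd p = last p \<longrightarrow> walk_gain G \<Psi> p = \<one>\<^bsub>G\<^esub>)"

definition cover_graph ::
  "('g, 'm) monoid_scheme \<Rightarrow> 'v pair_pre_digraph \<Rightarrow> ('v \<times> 'v \<Rightarrow> 'g) \<Rightarrow> ('v \<times> 'g) pair_pre_digraph"
where
  "cover_graph G \<Gamma> \<Psi> =
     \<lparr> pverts = pverts \<Gamma> \<times> carrier G,
       parcs = {((u, g), (v, h)) | u g v h.
         (u, v) \<in> parcs \<Gamma> \<and> g \<in> carrier G \<and> h \<in> carrier G \<and> h = inv\<^bsub>G\<^esub> \<Psi> (u, v) \<otimes>\<^bsub>G\<^esub> g} \<rparr>"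

definition disjoint_copies :: "nat \<Rightarrow> 'v pair_pre_digraph \<Rightarrow> (nat \<times> 'v) pair_pre_digraph" where
  "disjoint_copies k \<Gamma> =
     \<lparr> pverts = {..<k} \<times> pverts \<Gamma>,
       parcs = {((i, u), (i, v)) | i u v. i < k \<and> (u, v) \<in> parcs \<Gamma>} \<rparr>"

section \<open>Adjacency spectrum\<close>

definition adj_matrix_of :: "'v list \<Rightarrow> 'v pair_pre_digraph \<Rightarrow> real mat" where
  "adj_matrix_of vs \<Gamma> = mat (length vs) (length vs)
     (\<lambda>(i, j). if (vs ! i, vs ! j) \<in> parcs \<Gamma> then 1 else 0)"

text \<open>
  The matrix depends on an arbitrary choice of an ordering of the vertices; by
  \<open>char_poly_adj_matrix\<close> below, its characteristic polynomial, and hence everything defined from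
  the spectrum, does not.
\<close>

definition adj_matrix :: "'v pair_pre_digraph \<Rightarrow> real mat" where
  "adj_matrix \<Gamma> = adj_matrix_of (SOME vs. distinct vs \<and> set vs = pverts \<Gamma>) \<Gamma>"

text \<open>
  Eigenvalues with algebraic multiplicity.  The adjacency matrix of an undirected graph is real
  symmetric, so its characteristic polynomial splits over the reals and no eigenvalue is lost.
\<close>

definition adj_spectrum :: "'v pair_pre_digraph \<Rightarrow> real multiset" where
  "adj_spectrum \<Gamma> = proots (char_poly (adj_matrix \<Gamma>))"

definition max_eigenvalue :: "'v pair_pre_digraph \<Rightarrow> real" where
  "max_eigenvalue \<Gamma> = Max {x. eigenvalue (adj_matrix \<Gamma>) x}"

section \<open>Well-definedness\<close>

lemma pair_graph_cover_graph:
  assumes "group G" "finite (carrier G)" "pair_graph \<Gamma>" "gain_function G \<Gamma> \<Psi>"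
  shows "pair_graph (cover_graph G \<Gamma> \<Psi>)"
proof -
  interpret group G by fact
  interpret pair_graph \<Gamma> by fact
  let ?L = "cover_graph G \<Gamma> \<Psi>"
  have gain: "\<Psi> (u, v) \<in> carrier G" "inv\<^bsub>G\<^esub> \<Psi> (v, u) = \<Psi> (u, v)"
    if "(u, v) \<in> parcs \<Gamma>" for u v
    using assms(4) that unfolding gain_function_def by fastforce+
  have symm: "(v, u) \<in> parcs \<Gamma>" if "(u, v) \<in> parcs \<Gamma>" for u v
    using pair_sym_arcs that unfolding symmetric_def by (auto dest: symD)
  have sub: "parcs ?L \<subseteq> pverts ?L \<times> pverts ?L"
    by (auto simp: cover_graph_def dest: in_arcsD1 in_arcsD2)
  have fin: "finite (pverts ?L)"
    using assms(2) pair_finite_verts by (simp add: cover_graph_def)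
  have "sym (parcs ?L)"
  proof (rule symI)
    fix a b assume "(a, b) \<in> parcs ?L"
    then obtain u g v h where ab: "a = (u, g)" "b = (v, h)" and uv: "(u, v) \<in> parcs \<Gamma>"
      and g: "g \<in> carrier G" and h: "h \<in> carrier G" "h = inv\<^bsub>G\<^esub> \<Psi> (u, v) \<otimes>\<^bsub>G\<^esub> g"
      by (auto simp: cover_graph_def)
    have "\<Psi> (u, v) \<otimes>\<^bsub>G\<^esub> h = g"
      using gain(1)[OF uv] g h(2) by (simp add: m_assoc[symmetric])
    then show "(b, a) \<in> parcs ?L"
      using ab symm[OF uv] g h(1) gain(2)[OF uv] by (auto simp: cover_graph_def)
  qed
  then have symL: "symmetric (with_proj ?L)"
    by (simp add: symmetric_def)
  have wf: "fst e \<in> pverts ?L \<and> snd e \<in> pverts ?L" if "e \<in> parcs ?L" for e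
    using sub that by auto
  have finA: "finite (parcs ?L)"
    using sub fin by (meson finite_SigmaI finite_subset)
  have loop: "fst e \<noteq> snd e" if "e \<in> parcs ?L" for e
    using that pair_no_loops by (fastforce simp: cover_graph_def)
  show ?thesis
    using wf fin finA loop symL
    by (intro pair_graph.intro pair_digraph.intro pair_pseudo_graph.intro pair_fin_digraph.intro
        pair_sym_digraph.intro pair_loopfree_digraph.intro pair_wf_digraph.intro
        pair_fin_digraph_axioms.intro pair_sym_digraph_axioms.intro
        pair_loopfree_digraph_axioms.intro) simp_all
qed

lemma char_poly_adj_matrix_of:
  assumes "distinct vs" "distinct ws" "set vs = set ws"
  shows "char_poly (adj_matrix_of vs \<Gamma>) = char_poly (adj_matrix_of ws \<Gamma>)"
proof -
  let ?n = "length vs"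
  have len: "length ws = ?n"
    using distinct_card[OF assms(1)] distinct_card[OF assms(2)] assms(3) by simp
  define P :: "real mat" where "P = mat ?n ?n (\<lambda>(i, j). if vs ! i = ws ! j then 1 else 0)"
  define Q :: "real mat" where "Q = mat ?n ?n (\<lambda>(i, j). if ws ! i = vs ! j then 1 else 0)"
  define A where "A = adj_matrix_of vs \<Gamma>"
  define B where "B = adj_matrix_of ws \<Gamma>"
  obtain f where f: "\<And>i. i < ?n \<Longrightarrow> f i < ?n \<and> ws ! f i = vs ! i"
  proof -
    have "\<forall>i<?n. \<exists>j<?n. ws ! j = vs ! i"
      using assms(3) len by (metis in_set_conv_nth)
    then show ?thesis using that by metis
  qed
  obtain g where g: "\<And>i. i < ?n \<Longrightarrow> g i < ?n \<and> vs ! g i = ws ! i"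
  proof -
    have "\<forall>i<?n. \<exists>j<?n. vs ! j = ws ! i"
      using assms(3) len by (metis in_set_conv_nth)
    then show ?thesis using that by metis
  qed
  have P1: "P $$ (i, j) = (if j = f i then 1 else 0)" if "i < ?n" "j < ?n" for i j
    using that f[OF that(1)] nth_eq_iff_index_eq[OF assms(2), of j "f i"] len
    by (auto simp: P_def)
  have P2: "P $$ (i, j) = (if i = g j then 1 else 0)" if "i < ?n" "j < ?n" for i j
    using that g[OF that(2)] nth_eq_iff_index_eq[OF assms(1), of i "g j"]
    by (auto simp: P_def)
  have Q1: "Q $$ (i, j) = (if j = g i then 1 else 0)" if "i < ?n" "j < ?n" for i j
    using that g[OF that(1)] nth_eq_iff_index_eq[OF assms(1), of j "g i"]
    by (auto simp: Q_def)
  have Q2: "Q $$ (i, j) = (if i = f j then 1 else 0)" if "i < ?n" "j < ?n" for i j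
    using that f[OF that(2)] nth_eq_iff_index_eq[OF assms(2), of i "f j"] len
    by (auto simp: Q_def)
  have car: "P \<in> carrier_mat ?n ?n" "Q \<in> carrier_mat ?n ?n"
    "A \<in> carrier_mat ?n ?n" "B \<in> carrier_mat ?n ?n"
    by (auto simp: P_def Q_def A_def B_def adj_matrix_of_def len)
  have mult: "(X * Y) $$ (i, j) = (\<Sum>l<?n. X $$ (i, l) * Y $$ (l, j))"
    if "i < ?n" "j < ?n" "X \<in> carrier_mat ?n ?n" "Y \<in> carrier_mat ?n ?n"
    for i j and X Y :: "real mat"
    using that by (auto simp: scalar_prod_def atLeast0LessThan intro!: sum.cong)
  have pick: "(\<Sum>l<?n. (if l = c then 1 else 0) * h l) = h c"
    "(\<Sum>l<?n. h l * (if l = c then 1 else 0)) = h c"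
    if "c < ?n" for c and h :: "nat \<Rightarrow> real"
    using that by (simp_all add: sum.remove[of "{..<?n}" c])
  have PX: "(P * X) $$ (i, j) = X $$ (f i, j)"
    if "i < ?n" "j < ?n" "X \<in> carrier_mat ?n ?n" for i j X
  proof -
    have "(P * X) $$ (i, j) = (\<Sum>l<?n. (if l = f i then 1 else 0) * X $$ (l, j))"
      unfolding mult[OF that(1,2) car(1) that(3)]
      by (rule sum.cong) (use that in \<open>simp_all add: P1\<close>)
    then show ?thesis using f[OF that(1)] by (simp add: pick)
  qed
  have QX: "(Q * X) $$ (i, j) = X $$ (g i, j)"
    if "i < ?n" "j < ?n" "X \<in> carrier_mat ?n ?n" for i j X
  proof -
    have "(Q * X) $$ (i, j) = (\<Sum>l<?n. (if l = g i then 1 else 0) * X $$ (l, j))"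
      unfolding mult[OF that(1,2) car(2) that(3)]
      by (rule sum.cong) (use that in \<open>simp_all add: Q1\<close>)
    then show ?thesis using g[OF that(1)] by (simp add: pick)
  qed
  have XQ: "(X * Q) $$ (i, j) = X $$ (i, f j)"
    if "i < ?n" "j < ?n" "X \<in> carrier_mat ?n ?n" for i j X
  proof -
    have "(X * Q) $$ (i, j) = (\<Sum>l<?n. X $$ (i, l) * (if l = f j then 1 else 0))"
      unfolding mult[OF that(1,2) that(3) car(2)]
      by (rule sum.cong) (use that in \<open>simp_all add: Q2\<close>)
    then show ?thesis using f[OF that(2)] by (simp add: pick)
  qed
  have "P * Q = 1\<^sub>m ?n"
  proof (rule eq_matI)
    fix i j assume ij: "i < dim_row (1\<^sub>m ?n)" "j < dim_col (1\<^sub>m ?n)"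
    then show "(P * Q) $$ (i, j) = 1\<^sub>m ?n $$ (i, j)"
      using PX[of i j Q] car(2) f[of i] nth_eq_iff_index_eq[OF assms(1), of i j]
      by (auto simp: Q_def)
  qed (use car in auto)
  moreover have "Q * P = 1\<^sub>m ?n"
  proof (rule eq_matI)
    fix i j assume ij: "i < dim_row (1\<^sub>m ?n)" "j < dim_col (1\<^sub>m ?n)"
    then show "(Q * P) $$ (i, j) = 1\<^sub>m ?n $$ (i, j)"
      using QX[of i j P] car(1) g[of i] nth_eq_iff_index_eq[OF assms(2), of i j] len
      by (auto simp: P_def)
  qed (use car in auto)
  moreover have "A = P * B * Q"
  proof (rule eq_matI)
    fix i j assume "i < dim_row (P * B * Q)" "j < dim_col (P * B * Q)"
    then have ij: "i < ?n" "j < ?n" using car by auto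
    have "(P * B * Q) $$ (i, j) = B $$ (f i, f j)"
      using ij f[OF ij(2)] car by (simp only: XQ PX mult_carrier_mat)
    also have "\<dots> = A $$ (i, j)"
      using ij f[OF ij(1)] f[OF ij(2)] len by (simp add: A_def B_def adj_matrix_of_def)
    finally show "A $$ (i, j) = (P * B * Q) $$ (i, j)" ..
  qed (use car in auto)
  ultimately have "similar_mat_wit A B P Q"
    using car by (auto simp: similar_mat_wit_def Let_def)
  then show ?thesis
    unfolding A_def B_def by (intro char_poly_similar) (auto simp: similar_mat_def)
qed

lemma char_poly_adj_matrix:
  assumes "distinct vs" "set vs = pverts \<Gamma>"
  shows "char_poly (adj_matrix \<Gamma>) = char_poly (adj_matrix_of vs \<Gamma>)"
  unfolding adj_matrix_def
  by (rule someI2[of _ vs]) (use assms in \<open>auto intro!: char_poly_adj_matrix_of\<close>)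

end

theory Submission
  imports Defs
begin

text \<open>
  A balanced gain function has a potential \<open>f\<close> with \<open>\<Psi> (u, v) = f u \<otimes> inv (f v)\<close>, and this potential
  separates the cover graph into \<open>k\<close> sheets isomorphic to \<open>\<Gamma>\<close>; hence the spectrum of the cover is
  \<open>k\<close> times that of \<open>\<Gamma>\<close>, and the largest eigenvalue, which is simple for the connected graph \<open>\<Gamma>\<close>,
  gets multiplicity \<open>k\<close>.  Conversely, the positive Perron eigenfunction \<open>x\<close> of \<open>\<Gamma>\<close> lifts to the cover,
  and any other eigenfunction \<open>y\<close> of the cover for the same eigenvalue has \<open>y / x\<close> constant along
  arcs, because a weighted Dirichlet energy of \<open>y / x\<close> vanishes.  So \<open>y\<close> is determined by its values
  on the fibre over one vertex, and a closed walk with gain different from \<open>\<one>\<close> identifies two of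
  these \<open>k\<close> values: the multiplicity is then less than \<open>k\<close>.
\<close>

section \<open>Orthogonal diagonalization of real symmetric matrices\<close>

text \<open>A complex eigenvalue \<open>c\<close> with eigenvector \<open>v\<close> always exists.
  The Hermitian form \<open>q\<close> of \<open>A\<close> at \<open>v\<close> equals
  \<open>c\<close> times the squared norm of \<open>v\<close>, and by symmetry of \<open>A\<close>
  it is its own conjugate. So \<open>c\<close> is real, hence a root of the real characteristic
  polynomial.\<close>

lemma symmetric_eigenvalue_exists:
  fixes A :: "real mat"
  assumes A: "A \<in> carrier_mat n n" and sym: "transpose_mat A = A" and n: "n > 0"
  shows "\<exists>e. eigenvalue A e"
proof -
  let ?c = "complex_of_real"
  let ?B = "map_mat ?c A"
  have B: "?B \<in> carrier_mat n n" using A by simp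
  have Aij: "A $$ (i, j) = A $$ (j, i)" if "i < n" "j < n" for i j
    using arg_cong[OF sym, of "\<lambda>M. M $$ (j, i)"] A that by simp
  from spectrum_non_empty[OF B n] obtain c where "eigenvalue ?B c"
    by (auto simp: spectrum_def)
  then obtain v where v: "v \<in> carrier_vec n" "v \<noteq> 0\<^sub>v n" "?B *\<^sub>v v = c \<cdot>\<^sub>v v"
    using B by (auto simp: eigenvalue_def eigenvector_def)
  have row: "(\<Sum>j<n. ?c (A $$ (i, j)) * v $ j) = c * v $ i" if "i < n" for i
    using arg_cong[OF v(3), of "\<lambda>w. w $ i"] A v(1) that
    by (simp add: scalar_prod_def atLeast0LessThan)
  define q where "q = (\<Sum>i<n. \<Sum>j<n. cnj (v $ i) * ?c (A $$ (i, j)) * v $ j)"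
  have "q = (\<Sum>i<n. cnj (v $ i) * (c * v $ i))"
    unfolding q_def by (intro sum.cong refl) (simp add: row[symmetric] sum_distrib_left mult.assoc)
  also have "\<dots> = c * ?c (\<Sum>i<n. (cmod (v $ i))\<^sup>2)"
    unfolding of_real_sum sum_distrib_left
    by (intro sum.cong refl) (simp only: complex_norm_square mult_ac)
  finally have q: "q = c * ?c (\<Sum>i<n. (cmod (v $ i))\<^sup>2)" .
  have "cnj q = (\<Sum>i<n. \<Sum>j<n. cnj (v $ j) * ?c (A $$ (j, i)) * v $ i)"
    unfolding q_def cnj_sum by (intro sum.cong refl) (simp add: Aij mult_ac)
  also have "\<dots> = q" unfolding q_def by (rule sum.swap)
  finally have "Im q = 0" by (simp add: complex_eq_iff)
  obtain i where "i < n" "v $ i \<noteq> 0"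
    using v(1,2) by (metis carrier_vecD eq_vecI index_zero_vec)
  then have "(\<Sum>i<n. (cmod (v $ i))\<^sup>2) > 0"
    by (intro sum_pos2[of _ i]) auto
  with q \<open>Im q = 0\<close> have "Im c = 0" by simp
  then have c: "c = ?c (Re c)" by (simp add: complex_eq_iff)
  have "poly (char_poly ?B) (?c (Re c)) = 0"
    using \<open>eigenvalue ?B c\<close> c eigenvalue_root_char_poly[OF B] by simp
  then have "poly (char_poly A) (Re c) = 0"
    by (simp add: of_real_hom.char_poly_hom[OF A])
  then show ?thesis using eigenvalue_root_char_poly[OF A] by blast
qed

text \<open>This provides the deflation step of the diagonalization: for a unit eigenvector
  \<open>u\<close>, conjugation by \<open>W\<close> isolates its eigenvalue in the upper left
  corner.\<close>

lemma orthogonal_mat_with_first_col: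
  fixes u :: "real vec"
  assumes u: "u \<in> carrier_vec n" "u \<bullet> u = 1" and n: "n > 0"
  obtains W where "W \<in> carrier_mat n n" "transpose_mat W * W = 1\<^sub>m n" "col W 0 = u"
proof (cases "u = unit_vec n 0")
  case True
  then show ?thesis using n by (intro that[of "1\<^sub>m n"]) auto
next
  case False
  \<comment> \<open>The Householder reflection exchanging \<open>u\<close> and the first unit vector.\<close>
  define w where "w i = u $ i - (if i = 0 then 1 else 0)" for i
  define s where "s = (\<Sum>i<n. w i * w i)"
  define r where "r = 2 / s"
  define W where "W = mat n n (\<lambda>(i, j). (if i = j then 1 else 0) - r * w i * w j)"
  have uu: "(\<Sum>i<n. u $ i * u $ i) = 1"
    using u by (simp add: scalar_prod_def atLeast0LessThan)
  have "s = (\<Sum>i<n. u $ i * u $ i - (if i = 0 then 2 * u $ i - 1 else 0))"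
    unfolding s_def w_def by (intro sum.cong) (auto simp: algebra_simps)
  also have "\<dots> = - 2 * w 0"
    using n by (simp add: sum_subtractf uu w_def)
  finally have s: "s = - 2 * w 0" .
  have "\<exists>i<n. w i \<noteq> 0"
  proof (rule ccontr)
    assume "\<not> ?thesis"
    then have "u = unit_vec n 0" using u n by (intro eq_vecI) (auto simp: w_def)
    with False show False by simp
  qed
  then obtain i where "i < n" "w i \<noteq> 0" by blast
  then have "s > 0" unfolding s_def by (intro sum_pos2[of _ i]) (auto simp: zero_less_mult_iff)
  have "transpose_mat W * W = 1\<^sub>m n"
  proof (rule eq_matI)
    fix i j assume "i < dim_row (1\<^sub>m n)" "j < dim_col (1\<^sub>m n)"
    then have ij: "i < n" "j < n" by auto
    have "(transpose_mat W * W) $$ (i, j) = (\<Sum>l<n. W $$ (l, i) * W $$ (l, j))"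
      using ij by (simp add: W_def scalar_prod_def atLeast0LessThan)
    \<comment> \<open>The square of the reflection is expanded with Kronecker deltas as
      conditionals, so that the sums collapse. The terms in \<open>w i * w j\<close> then cancel
      because \<open>r * s = 2\<close>.\<close>
    also have "\<dots> = (\<Sum>l<n. (if l = i then if i = j then 1 else 0 else 0)
        - (if l = i then r * w l * w j else 0) - (if l = j then r * w i * w l else 0)
        + r * r * w i * w j * (w l * w l))"
      using ij by (intro sum.cong) (auto simp: W_def algebra_simps)
    also have "\<dots> = (if i = j then 1 else 0) - r * w i * w j - r * w i * w j
        + r * r * w i * w j * s"
      unfolding sum.distrib sum_subtractf sum_distrib_left[symmetric] s_def[symmetric]
      using ij by simp
    also have "\<dots> = 1\<^sub>m n $$ (i, j)"
      using ij \<open>s > 0\<close> by (simp add: r_def)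
    finally show "(transpose_mat W * W) $$ (i, j) = 1\<^sub>m n $$ (i, j)" .
  qed (auto simp: W_def)
  moreover have "col W 0 = u"
  proof (rule eq_vecI)
    fix i assume "i < dim_vec u"
    then have "i < n" using u by simp
    moreover have "w 0 \<noteq> 0" using s \<open>s > 0\<close> by auto
    then have "r * w i * w 0 = - w i" using s by (simp add: r_def field_simps)
    ultimately show "col W 0 $ i = u $ i" using n by (simp add: W_def w_def)
  qed (use u in \<open>auto simp: W_def\<close>)
  ultimately show ?thesis by (intro that[of W]) (auto simp: W_def)
qed

text \<open>Deflation: take an orthogonal \<open>W\<close> whose first column is a unit eigenvector.
  Then \<open>B = transpose_mat W * A * W\<close> has first column \<open>e\<close> times the first
  unit vector, and by symmetry the same first row. The induction hypothesis diagonalizes the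
  remaining block \<open>C\<close> by some \<open>Q\<close>, and \<open>W\<close> times the
  extension of \<open>Q\<close> by 1 diagonalizes \<open>A\<close>.\<close>

lemma symmetric_mat_diagonalization:
  fixes A :: "real mat"
  assumes "A \<in> carrier_mat n n" "transpose_mat A = A"
  shows "\<exists>P d. P \<in> carrier_mat n n \<and> transpose_mat P * P = 1\<^sub>m n \<and>
    transpose_mat P * A * P = mat_diag n d"
  using assms
proof (induction n arbitrary: A)
  case 0
  then show ?case by (intro exI[of _ "1\<^sub>m 0"] exI[of _ "\<lambda>_. 0"] conjI eq_matI) (auto simp: mat_diag_def)
next
  case (Suc n)
  note A = Suc.prems(1)
  obtain e where "eigenvalue A e" using symmetric_eigenvalue_exists[OF Suc.prems] by blast
  then obtain v where v: "v \<in> carrier_vec (Suc n)" "v \<noteq> 0\<^sub>v (Suc n)" "A *\<^sub>v v = e \<cdot>\<^sub>v v"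
    using A by (auto simp: eigenvalue_def eigenvector_def)
  have "v \<bullet> v > 0" using conjugate_square_greater_0_vec[OF v(1)] v(2) by simp
  define u where "u = (1 / sqrt (v \<bullet> v)) \<cdot>\<^sub>v v"
  have u: "u \<in> carrier_vec (Suc n)" "u \<bullet> u = 1" "A *\<^sub>v u = e \<cdot>\<^sub>v u"
    using v A \<open>v \<bullet> v > 0\<close>
    by (auto simp: u_def mult_mat_vec smult_smult_assoc mult.commute)
  obtain W where W: "W \<in> carrier_mat (Suc n) (Suc n)" "transpose_mat W * W = 1\<^sub>m (Suc n)"
    "col W 0 = u"
    using orthogonal_mat_with_first_col[OF u(1,2)] by auto
  define B where "B = transpose_mat W * A * W"
  have B: "B \<in> carrier_mat (Suc n) (Suc n)" using W A by (simp add: B_def)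
  have symB: "transpose_mat B = B"
    unfolding B_def using W(1) A Suc.prems(2)
    by (simp add: transpose_mult[of _ "Suc n" "Suc n" _ "Suc n"] assoc_mult_mat[of _ "Suc n" "Suc n" _ "Suc n" _ "Suc n"])
  have "transpose_mat W *\<^sub>v u = unit_vec (Suc n) 0"
  proof -
    have "transpose_mat W *\<^sub>v col W 0 = col (transpose_mat W * W) 0"
      using W(1) by (subst col_mult2[of _ "Suc n" "Suc n" _ "Suc n"]) auto
    then show ?thesis using W(2,3) by simp
  qed
  have "col B 0 = (transpose_mat W * A) *\<^sub>v col W 0"
    unfolding B_def using W(1) A by (intro col_mult2[of _ "Suc n" "Suc n" _ "Suc n"]) auto
  also have "\<dots> = transpose_mat W *\<^sub>v (A *\<^sub>v u)"
    unfolding W(3) using W(1) A u(1) by (intro assoc_mult_mat_vec[of _ "Suc n" "Suc n" _ "Suc n"]) auto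
  also have "\<dots> = e \<cdot>\<^sub>v unit_vec (Suc n) 0"
    using W(1) u \<open>transpose_mat W *\<^sub>v u = unit_vec (Suc n) 0\<close>
    by (simp add: mult_mat_vec[of _ "Suc n" "Suc n"])
  finally have colB: "col B 0 = e \<cdot>\<^sub>v unit_vec (Suc n) 0" .
  have B0: "B $$ (i, 0) = (if i = 0 then e else 0)" if "i < Suc n" for i
    using arg_cong[OF colB, of "\<lambda>w. w $ i"] B that by simp
  have B0': "B $$ (0, i) = (if i = 0 then e else 0)" if "i < Suc n" for i
    using arg_cong[OF symB, of "\<lambda>M. M $$ (i, 0)"] B0[OF that] B that by simp
  define C where "C = mat n n (\<lambda>(i, j). B $$ (Suc i, Suc j))"
  have C: "C \<in> carrier_mat n n" by (simp add: C_def)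
  have symC: "transpose_mat C = C"
  proof (rule eq_matI)
    fix i j assume "i < dim_row C" "j < dim_col C"
    then show "transpose_mat C $$ (i, j) = C $$ (i, j)"
      using arg_cong[OF symB, of "\<lambda>M. M $$ (Suc i, Suc j)"] B by (simp add: C_def)
  qed (auto simp: C_def)
  \<comment> \<open>Products and transposes of these block diagonal matrices are formed blockwise,
    which reduces the claims about \<open>?R\<close> to those about \<open>Q\<close>.\<close>
  define blk where "blk x M = four_block_mat (x \<cdot>\<^sub>m 1\<^sub>m 1) (0\<^sub>m 1 n) (0\<^sub>m n 1) M"
    for x :: real and M
  have blkB: "B = blk e C"
  proof (rule eq_matI)
    fix i j assume "i < dim_row (blk e C)" "j < dim_col (blk e C)"
    then have "i < Suc n" "j < Suc n" using C by (auto simp: blk_def)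
    then show "B $$ (i, j) = blk e C $$ (i, j)"
      using B0[of i] B0'[of j] C by (cases i; cases j) (simp_all add: C_def blk_def)
  qed (use B C in \<open>auto simp: blk_def\<close>)
  obtain Q d where Q: "Q \<in> carrier_mat n n" "transpose_mat Q * Q = 1\<^sub>m n"
    "transpose_mat Q * C * Q = mat_diag n d"
    using Suc.IH[OF C symC] by blast
  let ?R = "blk 1 Q"
  have R: "?R \<in> carrier_mat (Suc n) (Suc n)" using Q(1) by (auto simp: blk_def)
  have blk_mult: "blk x M * blk y N = blk (x * y) (M * N)"
    if "M \<in> carrier_mat n n" "N \<in> carrier_mat n n" for x y M N
    unfolding blk_def using that by (subst mult_four_block_mat[of _ 1 1 _ n _ n _ _ 1 _ n]) auto
  have RT: "transpose_mat ?R = blk 1 (transpose_mat Q)"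
    unfolding blk_def using Q(1) by (subst transpose_four_block_mat[of _ 1 1 _ n _ n]) auto
  have one: "blk 1 (1\<^sub>m n) = 1\<^sub>m (Suc n)" by (rule eq_matI) (auto simp: blk_def)
  let ?P = "W * ?R"
  have P: "?P \<in> carrier_mat (Suc n) (Suc n)" using W(1) R by simp
  note assoc = assoc_mult_mat[of _ "Suc n" "Suc n" _ "Suc n" _ "Suc n"]
  have PT: "transpose_mat ?P = transpose_mat ?R * transpose_mat W"
    using W(1) R by (rule transpose_mult)
  have RTc: "blk 1 (transpose_mat Q) \<in> carrier_mat (Suc n) (Suc n)"
    using R by (simp flip: RT)
  have "transpose_mat ?P * ?P = transpose_mat ?R * (transpose_mat W * W) * ?R"
    unfolding PT using W(1) R by (simp add: assoc)
  also have "\<dots> = 1\<^sub>m (Suc n)"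
    using Q(1,2) RTc by (simp add: W(2) RT blk_mult one)
  finally have PP: "transpose_mat ?P * ?P = 1\<^sub>m (Suc n)" .
  have "transpose_mat ?P * A * ?P = transpose_mat ?R * B * ?R"
    unfolding PT B_def using W(1) R A by (simp add: assoc)
  also have "\<dots> = blk e (mat_diag n d)"
    unfolding blkB RT using Q C by (simp add: blk_mult)
  also have "\<dots> = mat_diag (Suc n) (case_nat e d)"
    by (rule eq_matI) (auto simp: blk_def mat_diag_def split: nat.split)
  finally show ?case using P PP by blast
qed

lemma symmetric_mat_orthogonal_diagonalization:
  fixes A :: "real mat"
  assumes A: "A \<in> carrier_mat n n" and sym: "transpose_mat A = A"
  obtains P d where "P \<in> carrier_mat n n" "transpose_mat P * P = 1\<^sub>m n" "P * transpose_mat P = 1\<^sub>m n"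
    "A = P * mat_diag n d * transpose_mat P"
proof -
  obtain P d where P: "P \<in> carrier_mat n n" "transpose_mat P * P = 1\<^sub>m n"
    "transpose_mat P * A * P = mat_diag n d"
    using symmetric_mat_diagonalization[OF assms] by blast
  have inv: "P * transpose_mat P = 1\<^sub>m n"
    using mat_mult_left_right_inverse[of "transpose_mat P" n P] P(1,2) by simp
  have "P * mat_diag n d * transpose_mat P = (P * transpose_mat P) * A * (P * transpose_mat P)"
    unfolding P(3)[symmetric] using A P(1) by (simp add: assoc_mult_mat[of _ n n _ n _ n])
  then have "A = P * mat_diag n d * transpose_mat P" using inv A by simp
  with P inv show ?thesis by (intro that) auto
qed

section \<open>Eigenvalue multiplicities and Rayleigh quotients of symmetric matrices\<close>

lemma char_poly_mat_diag_similar: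
  fixes A :: "real mat"
  assumes "P \<in> carrier_mat n n" "Q * P = 1\<^sub>m n" "P * Q = 1\<^sub>m n" "Q \<in> carrier_mat n n"
    "A = P * mat_diag n d * Q"
  shows "char_poly A = (\<Prod>i<n. [:- d i, 1:])"
proof -
  have "similar_mat A (mat_diag n d)"
    using assms by (intro similar_matI[of _ _ P Q n]) auto
  then have "char_poly A = char_poly (mat_diag n d)" by (rule char_poly_similar)
  also have "\<dots> = (\<Prod>a\<leftarrow>diag_mat (mat_diag n d). [:- a, 1:])"
    by (rule char_poly_upper_triangular[of _ n]) (auto simp: mat_diag_def)
  also have "diag_mat (mat_diag n d) = map d [0..<n]"
    by (auto simp: diag_mat_def mat_diag_def)
  also have "(\<Prod>a\<leftarrow>map d [0..<n]. [:- a, 1:]) = (\<Prod>i<n. [:- d i, 1:])"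
    by (simp add: o_def prod.list_conv_set_nth atLeast0LessThan)
  finally show ?thesis .
qed

lemma order_prod_linear:
  fixes d :: "'b \<Rightarrow> 'a :: idom"
  assumes "finite I"
  shows "order e (\<Prod>i\<in>I. [:- d i, 1:]) = card {i \<in> I. d i = e}"
  using assms
proof (induction I)
  case (insert j I)
  have eq: "{i \<in> insert j I. d i = e} = (if d j = e then insert j {i \<in> I. d i = e} else {i \<in> I. d i = e})"
    by auto
  have lin: "order e [:- d j, 1:] = (if e = d j then 1 else 0)"
    using order_linear_power[of e "- d j" 1] by auto
  have "(\<Prod>i\<in>insert j I. [:- d i, 1:]) \<noteq> 0"
    by (subst prod_zero_iff) (use insert.hyps in auto)
  then have "order e (\<Prod>i\<in>insert j I. [:- d i, 1:]) = order e [:- d j, 1:] + order e (\<Prod>i\<in>I. [:- d i, 1:])"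
    unfolding prod.insert[OF insert.hyps] by (rule order_mult)
  then show ?case
    unfolding insert.IH lin eq using insert.hyps by simp
qed auto

text \<open>The system is padded with zero rows to a square matrix. Row \<open>s\<close> is zero, so
  Laplace expansion along it gives determinant 0 and thus a nonzero kernel vector.\<close>

lemma underdetermined_system_solution:
  fixes c :: "nat \<Rightarrow> nat \<Rightarrow> 'a :: idom"
  assumes "s < m"
  obtains z where "z \<in> carrier_vec m" "z \<noteq> 0\<^sub>v m" "\<And>i. i < s \<Longrightarrow> (\<Sum>j<m. c i j * z $ j) = 0"
proof -
  define M where "M = mat m m (\<lambda>(i, j). if i < s then c i j else 0)"
  have M: "M \<in> carrier_mat m m" by (simp add: M_def)
  have "det M = 0"
    using laplace_expansion_row[OF M assms] assms by (simp add: M_def)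
  then obtain z where z: "z \<in> carrier_vec m" "z \<noteq> 0\<^sub>v m" "M *\<^sub>v z = 0\<^sub>v m"
    using det_0_iff_vec_prod_zero[OF M] by blast
  have "(\<Sum>j<m. c i j * z $ j) = 0" if "i < s" for i
    using arg_cong[OF z(3), of "\<lambda>w. w $ i"] that assms z(1)
    by (simp add: M_def scalar_prod_def atLeast0LessThan)
  with z show ?thesis by (intro that) auto
qed

text \<open>The hypothesis says that an eigenvector for \<open>e\<close> is determined by its
  entries on \<open>S\<close>. The multiplicity of \<open>e\<close> is the number of columns of
  \<open>P\<close> belonging to \<open>e\<close>. If these outnumbered \<open>S\<close>, a
  nontrivial combination of them would vanish on \<open>S\<close>, although the columns are
  independent.\<close>

lemma order_char_poly_le_card:
  fixes A :: "real mat"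
  assumes A: "A \<in> carrier_mat n n" and sym: "transpose_mat A = A" and S: "S \<subseteq> {..<n}"
    and det: "\<And>y. y \<in> carrier_vec n \<Longrightarrow> A *\<^sub>v y = e \<cdot>\<^sub>v y \<Longrightarrow> \<forall>i\<in>S. y $ i = 0 \<Longrightarrow> y = 0\<^sub>v n"
  shows "order e (char_poly A) \<le> card S"
proof (rule ccontr)
  obtain P d where P: "P \<in> carrier_mat n n" "transpose_mat P * P = 1\<^sub>m n" "P * transpose_mat P = 1\<^sub>m n"
    and AP: "A = P * mat_diag n d * transpose_mat P"
    using symmetric_mat_orthogonal_diagonalization[OF A sym] by blast
  define J where "J = {i. i < n \<and> d i = e}"
  have "order e (char_poly A) = card J"
    using char_poly_mat_diag_similar[OF P(1,2,3) _ AP] P(1) by (simp add: order_prod_linear J_def)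
  moreover assume "\<not> order e (char_poly A) \<le> card S"
  ultimately have less: "card S < card J" by simp
  have "finite S" "finite J" using S finite_subset by (auto simp: J_def)
  obtain g where g: "bij_betw g {0..<card S} S" using ex_bij_betw_nat_finite[OF \<open>finite S\<close>] by blast
  obtain h where h: "bij_betw h {0..<card J} J" using ex_bij_betw_nat_finite[OF \<open>finite J\<close>] by blast
  obtain z where z: "z \<in> carrier_vec (card J)" "z \<noteq> 0\<^sub>v (card J)"
    "\<And>i. i < card S \<Longrightarrow> (\<Sum>j<card J. P $$ (g i, h j) * z $ j) = 0"
    using underdetermined_system_solution[OF less, of "\<lambda>i j. P $$ (g i, h j)"] by blast
  \<comment> \<open>\<open>w\<close> carries the coefficients \<open>z\<close> on the index set
    \<open>J\<close> and is zero elsewhere, so \<open>P *\<^sub>v w\<close> is the wanted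
    combination of the columns for \<open>e\<close>.\<close>
  define h' where "h' = inv_into {0..<card J} h"
  define w where "w = vec n (\<lambda>i. if i \<in> J then z $ h' i else 0)"
  have w: "w \<in> carrier_vec n" by (simp add: w_def)
  have wh: "w $ h j = z $ j" if "j < card J" for j
  proof -
    have "h j \<in> J" using h that by (auto simp: bij_betw_def)
    moreover have "h' (h j) = j"
      unfolding h'_def using h that by (auto simp: bij_betw_def intro: inv_into_f_f)
    ultimately show ?thesis by (simp add: w_def J_def)
  qed
  let ?y = "P *\<^sub>v w"
  have y: "?y \<in> carrier_vec n" using P(1) w by simp
  have PTy: "transpose_mat P *\<^sub>v ?y = w"
    using P w by (simp add: assoc_mult_mat_vec[symmetric, of _ n n _ n])
  have "mat_diag n d *\<^sub>v w = e \<cdot>\<^sub>v w"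
  proof (rule eq_vecI)
    fix i assume "i < dim_vec (e \<cdot>\<^sub>v w)"
    then have "i < n" using w by simp
    moreover have "(\<Sum>j<n. (if i = j then d j else 0) * w $ j) = (\<Sum>j<n. if j = i then d i * w $ i else 0)"
      by (intro sum.cong) auto
    ultimately have "(mat_diag n d *\<^sub>v w) $ i = d i * w $ i"
      using w by (simp add: mat_diag_def scalar_prod_def atLeast0LessThan)
    also have "\<dots> = e * w $ i" using \<open>i < n\<close> by (simp add: w_def J_def)
    finally show "(mat_diag n d *\<^sub>v w) $ i = (e \<cdot>\<^sub>v w) $ i" using \<open>i < n\<close> w by simp
  qed (use w in \<open>auto simp: mat_diag_def\<close>)
  moreover have "A *\<^sub>v ?y = P *\<^sub>v (mat_diag n d *\<^sub>v (transpose_mat P *\<^sub>v ?y))"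
    unfolding AP using P(1) w by (simp add: assoc_mult_mat_vec[of _ n n _ n])
  ultimately have "A *\<^sub>v ?y = e \<cdot>\<^sub>v ?y"
    unfolding PTy using P(1) w by (simp add: mult_mat_vec)
  moreover have "\<forall>i\<in>S. ?y $ i = 0"
  proof
    fix i assume "i \<in> S"
    then obtain l where l: "l < card S" "i = g l"
      using g by (metis atLeast0LessThan bij_betw_imp_surj_on imageE lessThan_iff)
    have "i < n" using \<open>i \<in> S\<close> S by auto
    then have "?y $ i = (\<Sum>j<n. P $$ (i, j) * w $ j)"
      using P(1) w by (simp add: scalar_prod_def atLeast0LessThan)
    also have "\<dots> = (\<Sum>j\<in>J. P $$ (i, j) * w $ j)"
      by (rule sum.mono_neutral_right) (auto simp: J_def w_def)
    also have "\<dots> = (\<Sum>j\<in>{0..<card J}. P $$ (i, h j) * w $ h j)"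
      using sum.reindex_bij_betw[OF h, of "\<lambda>j. P $$ (i, j) * w $ j"] by simp
    also have "\<dots> = (\<Sum>j<card J. P $$ (g l, h j) * z $ j)"
      using wh l by (simp add: atLeast0LessThan)
    finally show "?y $ i = 0" using z(3)[OF l(1)] by simp
  qed
  ultimately have "?y = 0\<^sub>v n" using det[OF y] by blast
  moreover have "transpose_mat P *\<^sub>v 0\<^sub>v n = 0\<^sub>v n"
    using P(1) by (intro eq_vecI) (auto simp: scalar_prod_def)
  ultimately have "w = 0\<^sub>v n" using PTy by simp
  moreover have "h j < n" if "j < card J" for j
    using h that by (auto simp: bij_betw_def J_def)
  ultimately have "z = 0\<^sub>v (card J)"
    using wh z(1) by (intro eq_vecI) auto
  with z(2) show False by simp
qed

text \<open>In the coordinates \<open>w\<close> of \<open>x\<close> with respect to the orthonormal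
  eigenbasis, the inequality reads: the sum of \<open>(m - d i) * (w $ i * w $ i)\<close> is at most
  0. All terms are nonnegative, so \<open>w\<close> is supported where
  \<open>d i = m\<close>.\<close>

lemma rayleigh_maximizer_eigenvector:
  fixes A :: "real mat"
  assumes A: "A \<in> carrier_mat n n" and sym: "transpose_mat A = A"
    and max: "\<And>e. eigenvalue A e \<Longrightarrow> e \<le> m"
    and x: "x \<in> carrier_vec n" "m * (x \<bullet> x) \<le> x \<bullet> (A *\<^sub>v x)"
  shows "A *\<^sub>v x = m \<cdot>\<^sub>v x"
proof -
  obtain P d where P: "P \<in> carrier_mat n n" "transpose_mat P * P = 1\<^sub>m n" "P * transpose_mat P = 1\<^sub>m n"
    and AP: "A = P * mat_diag n d * transpose_mat P"
    using symmetric_mat_orthogonal_diagonalization[OF A sym] by blast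
  have d: "d i \<le> m" if "i < n" for i
  proof -
    have "poly (char_poly A) (d i) = 0"
      using char_poly_mat_diag_similar[OF P(1,2,3) _ AP] P(1) that
      by (auto simp: poly_prod)
    then show ?thesis using max eigenvalue_root_char_poly[OF A] by blast
  qed
  define w where "w = transpose_mat P *\<^sub>v x"
  have w: "w \<in> carrier_vec n" using P(1) x by (simp add: w_def)
  have Pw: "P *\<^sub>v w = x"
    unfolding w_def using P x by (simp add: assoc_mult_mat_vec[symmetric, of _ n n _ n])
  define z where "z = mat_diag n d *\<^sub>v w"
  have Dw: "z $ i = d i * w $ i" if "i < n" for i
  proof -
    have "(\<Sum>j<n. (if i = j then d j else 0) * w $ j) = (\<Sum>j<n. if j = i then d i * w $ i else 0)"
      by (intro sum.cong) auto
    then show ?thesis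
      using w that by (simp add: z_def mat_diag_def scalar_prod_def atLeast0LessThan)
  qed
  have Dwc: "z \<in> carrier_vec n" unfolding z_def using w by (rule mult_mat_vec_carrier[OF mat_diag_dim])
  have Ax: "A *\<^sub>v x = P *\<^sub>v z"
    unfolding AP w_def z_def using P(1) x by (simp add: assoc_mult_mat_vec[of _ n n _ n])
  have adj: "x \<bullet> (P *\<^sub>v y) = w \<bullet> y" if "y \<in> carrier_vec n" for y
    unfolding w_def using transpose_vec_mult_scalar[OF P(1) that x(1)] by simp
  have "x \<bullet> x = (\<Sum>i<n. w $ i * w $ i)"
    using adj[OF w] w by (simp add: Pw scalar_prod_def atLeast0LessThan)
  moreover have "x \<bullet> (A *\<^sub>v x) = (\<Sum>i<n. d i * (w $ i * w $ i))"
    unfolding Ax adj[OF Dwc] using w Dwc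
    by (auto simp: scalar_prod_def atLeast0LessThan Dw mult_ac intro!: sum.cong)
  ultimately have "(\<Sum>i<n. (m - d i) * (w $ i * w $ i)) \<le> 0"
    using x(2) by (simp add: left_diff_distrib sum_subtractf sum_distrib_left)
  moreover have nonneg: "(m - d i) * (w $ i * w $ i) \<ge> 0" if "i < n" for i
    using d[OF that] by simp
  ultimately have "(\<Sum>i<n. (m - d i) * (w $ i * w $ i)) = 0"
    by (intro antisym sum_nonneg) auto
  then have "(m - d i) * (w $ i * w $ i) = 0" if "i < n" for i
    using sum_nonneg_eq_0_iff[of "{..<n}" "\<lambda>i. (m - d i) * (w $ i * w $ i)"] nonneg that by auto
  then have "z = m \<cdot>\<^sub>v w"
    using w Dwc by (intro eq_vecI) (auto simp: Dw)
  then show ?thesis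
    unfolding Ax using P(1) w Pw by (simp add: mult_mat_vec)
qed

section \<open>Eigenfunctions of graphs\<close>

definition eigenfunction :: "'v pair_pre_digraph \<Rightarrow> real \<Rightarrow> ('v \<Rightarrow> real) \<Rightarrow> bool" where
  "eigenfunction \<Gamma> e f \<longleftrightarrow> (\<forall>u\<in>pverts \<Gamma>. (\<Sum>v\<in>parcs \<Gamma> `` {u}. f v) = e * f u)"

lemma (in pair_graph) parcs_sym: "(u, v) \<in> parcs G \<Longrightarrow> (v, u) \<in> parcs G"
  using pair_sym_arcs unfolding symmetric_def by (auto dest: symD)

lemma (in pair_graph) finite_nbs: "finite (parcs G `` {u})"
  using pair_finite_arcs by (rule finite_Image)

lemma (in pair_graph) nbs_subset: "parcs G `` {u} \<subseteq> pverts G"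
  by (auto dest: in_arcsD2)

text \<open>Both double sums run over all arcs, and reversing arcs permutes them.\<close>

lemma (in pair_graph) sum_nbs_swap:
  "(\<Sum>u\<in>pverts G. \<Sum>v\<in>parcs G `` {u}. f u v) = (\<Sum>u\<in>pverts G. \<Sum>v\<in>parcs G `` {u}. f v u)"
proof -
  have nbs: "parcs G `` {u} = {v \<in> pverts G. (u, v) \<in> parcs G}"
    "parcs G `` {u} = {v \<in> pverts G. (v, u) \<in> parcs G}" for u
    using nbs_subset by (auto intro: parcs_sym)
  have "(\<Sum>u\<in>pverts G. \<Sum>v\<in>parcs G `` {u}. f u v) =
      (\<Sum>v\<in>pverts G. \<Sum>u\<in>{u \<in> pverts G. (u, v) \<in> parcs G}. f u v)"
    unfolding nbs(1) by (rule sum.swap_restrict[OF pair_finite_verts pair_finite_verts])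
  then show ?thesis unfolding nbs(2)[symmetric] .
qed

section \<open>From adjacency matrices to functions on vertices\<close>

lemma obtain_vertex_ordering:
  assumes "pair_graph \<Gamma>"
  obtains vs where "distinct vs" "set vs = pverts \<Gamma>" "adj_matrix \<Gamma> = adj_matrix_of vs \<Gamma>"
proof -
  interpret pair_graph \<Gamma> by fact
  obtain xs where "distinct xs \<and> set xs = pverts \<Gamma>"
    using finite_distinct_list[OF pair_finite_verts] by blast
  then have "distinct (SOME vs. distinct vs \<and> set vs = pverts \<Gamma>) \<and> set (SOME vs. distinct vs \<and> set vs = pverts \<Gamma>) = pverts \<Gamma>"
    by (rule someI)
  then show ?thesis by (intro that) (auto simp: adj_matrix_def)
qed

lemma adj_matrix_of_carrier: "adj_matrix_of vs \<Gamma> \<in> carrier_mat (length vs) (length vs)"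
  by (simp add: adj_matrix_of_def)

lemma (in pair_graph) transpose_adj_matrix_of: "transpose_mat (adj_matrix_of vs G) = adj_matrix_of vs G"
  by (rule eq_matI) (auto simp: adj_matrix_of_def intro: parcs_sym)

lemma sum_nth_distinct:
  assumes "distinct vs"
  shows "(\<Sum>i<length vs. f (vs ! i)) = (\<Sum>v\<in>set vs. f v)"
  using sum.reindex_bij_betw[OF bij_betw_nth[OF assms refl refl], of f] by simp

lemma (in pair_graph) adj_matrix_of_mult_vec:
  assumes vs: "distinct vs" "set vs = pverts G" and i: "i < length vs"
  shows "(adj_matrix_of vs G *\<^sub>v vec (length vs) (\<lambda>i. f (vs ! i))) $ i = (\<Sum>v\<in>parcs G `` {vs ! i}. f v)"
proof -
  have "(adj_matrix_of vs G *\<^sub>v vec (length vs) (\<lambda>i. f (vs ! i))) $ i =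
      (\<Sum>j<length vs. (if (vs ! i, vs ! j) \<in> parcs G then 1 else 0) * f (vs ! j))"
    using i by (simp add: adj_matrix_of_def scalar_prod_def atLeast0LessThan)
  also have "\<dots> = (\<Sum>v\<in>set vs. (if (vs ! i, v) \<in> parcs G then 1 else 0) * f v)"
    by (rule sum_nth_distinct[OF vs(1)])
  also have "\<dots> = (\<Sum>v\<in>parcs G `` {vs ! i}. f v)"
    using nbs_subset[of "vs ! i"] vs(2) by (intro sum.mono_neutral_cong_right) auto
  finally show ?thesis .
qed

lemma (in pair_graph) eigenfunction_iff:
  assumes "distinct vs" "set vs = pverts G"
  shows "eigenfunction G e f \<longleftrightarrow>
    adj_matrix_of vs G *\<^sub>v vec (length vs) (\<lambda>i. f (vs ! i)) = e \<cdot>\<^sub>v vec (length vs) (\<lambda>i. f (vs ! i))"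
    (is "_ \<longleftrightarrow> ?A *\<^sub>v ?f = _")
proof
  assume "eigenfunction G e f"
  then show "?A *\<^sub>v ?f = e \<cdot>\<^sub>v ?f"
    using assms adj_matrix_of_carrier[of vs G]
    by (intro eq_vecI) (auto simp: adj_matrix_of_mult_vec eigenfunction_def simp del: index_mult_mat_vec)
next
  assume eq: "?A *\<^sub>v ?f = e \<cdot>\<^sub>v ?f"
  show "eigenfunction G e f"
    unfolding eigenfunction_def
  proof
    fix u assume "u \<in> pverts G"
    then obtain i where "i < length vs" "vs ! i = u" using assms(2) by (metis in_set_conv_nth)
    then show "(\<Sum>v\<in>parcs G `` {u}. f v) = e * f u"
      using arg_cong[OF eq, of "\<lambda>w. w $ i"] adj_matrix_of_mult_vec[OF assms, of i f] by simp
  qed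
qed

lemma vec_as_function:
  assumes "distinct vs" "y \<in> carrier_vec (length vs)"
  obtains f where "y = vec (length vs) (\<lambda>i. f (vs ! i))"
proof -
  have "inj_on ((!) vs) {..<length vs}" using assms(1) by (simp add: inj_on_nth)
  then have "y = vec (length vs) (\<lambda>i. y $ inv_into {..<length vs} ((!) vs) (vs ! i))"
    using assms(2) by (intro eq_vecI) auto
  then show ?thesis by (rule that)
qed

lemma (in pair_graph) eigenvalue_adj_matrix_iff:
  "eigenvalue (adj_matrix G) e \<longleftrightarrow> (\<exists>f. eigenfunction G e f \<and> (\<exists>u\<in>pverts G. f u \<noteq> 0))"
proof -
  obtain vs where vs: "distinct vs" "set vs = pverts G" "adj_matrix G = adj_matrix_of vs G"
    using obtain_vertex_ordering[OF pair_graph_axioms] .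
  let ?n = "length vs"
  have dim: "dim_row (adj_matrix_of vs G) = ?n" using adj_matrix_of_carrier[of vs G] by auto
  have nz: "vec ?n (\<lambda>i. f (vs ! i)) \<noteq> 0\<^sub>v ?n \<longleftrightarrow> (\<exists>u\<in>pverts G. f u \<noteq> 0)" for f :: "'a \<Rightarrow> real"
    unfolding vs(2)[symmetric] vec_eq_iff by (auto simp: in_set_conv_nth) (metis nth_mem)
  show ?thesis
    unfolding eigenvalue_def eigenvector_def vs(3) dim eigenfunction_iff[OF vs(1,2)] nz[symmetric]
    by (metis vec_as_function[OF vs(1)] vec_carrier)
qed

text \<open>\<open>proots\<close> reflects the roots faithfully only for a nonzero polynomial; a
  characteristic polynomial is monic.\<close>

lemma char_poly_adj_matrix_nonzero: "char_poly (adj_matrix \<Gamma>) \<noteq> 0"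
proof -
  have "adj_matrix \<Gamma> \<in> carrier_mat (dim_row (adj_matrix \<Gamma>)) (dim_row (adj_matrix \<Gamma>))"
    by (simp add: adj_matrix_def adj_matrix_of_def)
  from degree_monic_char_poly[OF this] show ?thesis by auto
qed

lemma set_adj_spectrum: "set_mset (adj_spectrum \<Gamma>) = {e. eigenvalue (adj_matrix \<Gamma>) e}"
proof -
  have "adj_matrix \<Gamma> \<in> carrier_mat (dim_row (adj_matrix \<Gamma>)) (dim_row (adj_matrix \<Gamma>))"
    by (simp add: adj_matrix_def adj_matrix_of_def)
  from eigenvalue_root_char_poly[OF this] show ?thesis
    by (simp add: adj_spectrum_def char_poly_adj_matrix_nonzero)
qed

text \<open>This form makes the maximum visibly one over a finite set, and lets it be compared
  between graphs through their spectra.\<close>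

lemma max_eigenvalue_spectrum: "max_eigenvalue \<Gamma> = Max (set_mset (adj_spectrum \<Gamma>))"
  by (simp add: max_eigenvalue_def set_adj_spectrum)

lemma eigenvalue_le_max_eigenvalue:
  "eigenvalue (adj_matrix \<Gamma>) e \<Longrightarrow> e \<le> max_eigenvalue \<Gamma>"
  unfolding max_eigenvalue_spectrum by (rule Max_ge) (simp_all, simp add: set_adj_spectrum)

lemma (in pair_graph) eigenvalue_max_eigenvalue:
  assumes "pverts G \<noteq> {}"
  shows "eigenvalue (adj_matrix G) (max_eigenvalue G)"
proof -
  obtain vs where vs: "distinct vs" "set vs = pverts G" "adj_matrix G = adj_matrix_of vs G"
    using obtain_vertex_ordering[OF pair_graph_axioms] .
  have "length vs > 0" using assms vs(2) by auto
  then have "set_mset (adj_spectrum G) \<noteq> {}"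
    using symmetric_eigenvalue_exists[OF adj_matrix_of_carrier transpose_adj_matrix_of]
    by (auto simp: set_adj_spectrum vs(3) simp del: set_mset_eq_empty_iff)
  then have "max_eigenvalue G \<in> set_mset (adj_spectrum G)"
    unfolding max_eigenvalue_spectrum by (intro Max_in) auto
  then show ?thesis by (simp add: set_adj_spectrum)
qed

text \<open>The bound is used twice: with a single vertex, for the simplicity of the largest
  eigenvalue of a connected graph, and with a fibre lacking one point, for the cover.\<close>

lemma (in pair_graph) count_adj_spectrum_le_card:
  assumes S: "S \<subseteq> pverts G"
    and det: "\<And>f u. eigenfunction G e f \<Longrightarrow> (\<And>s. s \<in> S \<Longrightarrow> f s = 0) \<Longrightarrow> u \<in> pverts G \<Longrightarrow> f u = 0"
  shows "count (adj_spectrum G) e \<le> card S"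
proof -
  obtain vs where vs: "distinct vs" "set vs = pverts G" "adj_matrix G = adj_matrix_of vs G"
    using obtain_vertex_ordering[OF pair_graph_axioms] .
  let ?n = "length vs"
  define I where "I = {i. i < ?n \<and> vs ! i \<in> S}"
  have "card I = card S"
  proof (rule bij_betw_same_card[of "(!) vs"])
    have "inj_on ((!) vs) I" using vs(1) by (auto simp: I_def intro!: inj_on_nth)
    moreover have "(!) vs ` I = S"
    proof
      show "S \<subseteq> (!) vs ` I"
      proof
        fix s assume "s \<in> S"
        then have "s \<in> set vs" using S vs(2) by blast
        then obtain i where "i < ?n" "vs ! i = s" unfolding in_set_conv_nth by blast
        with \<open>s \<in> S\<close> show "s \<in> (!) vs ` I" by (auto simp: I_def)
      qed
    qed (auto simp: I_def)
    ultimately show "bij_betw ((!) vs) I S" by (simp add: bij_betw_def)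
  qed
  moreover have "order e (char_poly (adj_matrix_of vs G)) \<le> card I"
  proof (rule order_char_poly_le_card[OF adj_matrix_of_carrier transpose_adj_matrix_of])
    fix y assume y: "y \<in> carrier_vec ?n" "adj_matrix_of vs G *\<^sub>v y = e \<cdot>\<^sub>v y" "\<forall>i\<in>I. y $ i = 0"
    obtain f where f: "y = vec ?n (\<lambda>i. f (vs ! i))" using vec_as_function[OF vs(1) y(1)] .
    have "f s = 0" if "s \<in> S" for s
    proof -
      have "s \<in> set vs" using that S vs(2) by blast
      then obtain i where i: "i < ?n" "vs ! i = s" unfolding in_set_conv_nth by blast
      then have "y $ i = 0" using y(3) that unfolding I_def by blast
      then show ?thesis unfolding f using i by simp
    qed
    moreover have "eigenfunction G e f" using y(2) eigenfunction_iff[OF vs(1,2)] f by simp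
    ultimately have "f (vs ! i) = 0" if "i < ?n" for i using det vs(2) that nth_mem by metis
    then show "y = 0\<^sub>v ?n" unfolding f by (intro eq_vecI) auto
  qed (auto simp: I_def)
  ultimately show ?thesis
    by (simp add: adj_spectrum_def char_poly_adj_matrix_nonzero vs(3)[symmetric])
qed

lemma (in pair_graph) rayleigh_maximizer_eigenfunction:
  assumes "max_eigenvalue G * (\<Sum>u\<in>pverts G. f u * f u) \<le> (\<Sum>u\<in>pverts G. f u * (\<Sum>v\<in>parcs G `` {u}. f v))"
  shows "eigenfunction G (max_eigenvalue G) f"
proof -
  obtain vs where vs: "distinct vs" "set vs = pverts G" "adj_matrix G = adj_matrix_of vs G"
    using obtain_vertex_ordering[OF pair_graph_axioms] .
  let ?n = "length vs" and ?A = "adj_matrix_of vs G"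
  let ?f = "vec ?n (\<lambda>i. f (vs ! i))"
  have dim: "dim_row ?A = ?n" using adj_matrix_of_carrier[of vs G] by auto
  have "?f \<bullet> ?f = (\<Sum>i<?n. f (vs ! i) * f (vs ! i))"
    by (simp add: scalar_prod_def atLeast0LessThan)
  also have "\<dots> = (\<Sum>u\<in>pverts G. f u * f u)"
    using sum_nth_distinct[OF vs(1), of "\<lambda>u. f u * f u"] vs(2) by simp
  finally have ff: "?f \<bullet> ?f = (\<Sum>u\<in>pverts G. f u * f u)" .
  have "?f \<bullet> (?A *\<^sub>v ?f) = (\<Sum>i<?n. f (vs ! i) * (?A *\<^sub>v ?f) $ i)"
    using dim by (simp add: scalar_prod_def[of ?f] atLeast0LessThan)
  also have "\<dots> = (\<Sum>i<?n. f (vs ! i) * (\<Sum>v\<in>parcs G `` {vs ! i}. f v))"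
    by (intro sum.cong refl) (simp add: adj_matrix_of_mult_vec[OF vs(1,2)] del: index_mult_mat_vec)
  also have "\<dots> = (\<Sum>u\<in>pverts G. f u * (\<Sum>v\<in>parcs G `` {u}. f v))"
    using sum_nth_distinct[OF vs(1), of "\<lambda>u. f u * (\<Sum>v\<in>parcs G `` {u}. f v)"] vs(2) by simp
  finally have fAf: "?f \<bullet> (?A *\<^sub>v ?f) = (\<Sum>u\<in>pverts G. f u * (\<Sum>v\<in>parcs G `` {u}. f v))" .
  have "?A *\<^sub>v ?f = max_eigenvalue G \<cdot>\<^sub>v ?f"
    by (rule rayleigh_maximizer_eigenvector[OF adj_matrix_of_carrier transpose_adj_matrix_of])
      (use assms eigenvalue_le_max_eigenvalue[of G] in \<open>auto simp: ff fAf vs(3)\<close>)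
  then show ?thesis using eigenfunction_iff[OF vs(1,2)] by simp
qed

section \<open>Perron eigenfunction and simplicity of the largest eigenvalue\<close>

lemma (in pair_graph) connected_reachable:
  assumes "Digraph_Component.connected (with_proj G)" "u \<in> pverts G" "v \<in> pverts G"
  shows "u \<rightarrow>\<^sup>*\<^bsub>with_proj G\<^esub> v"
  using symmetric_connected_imp_strongly_connected[OF _ assms(1)] pair_sym_arcs assms(2,3)
  by (auto simp: strongly_connected_def)

text \<open>Passing from an eigenfunction \<open>y\<close> to its absolute value keeps the norm and
  does not decrease the quadratic form, so the absolute value is again an eigenfunction for the
  maximum. At a zero of it, the nonnegative values at the neighbours sum to 0; zeros therefore
  spread over the connected graph, contradicting that \<open>y\<close> is nonzero.\<close>

lemma (in pair_graph) perron_eigenfunction: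
  assumes conn: "Digraph_Component.connected (with_proj G)"
  obtains x where "eigenfunction G (max_eigenvalue G) x" "\<And>u. u \<in> pverts G \<Longrightarrow> x u > 0"
proof -
  let ?m = "max_eigenvalue G"
  have "pverts G \<noteq> {}" using conn by (auto simp: connected_conv)
  then obtain y where y: "eigenfunction G ?m y" "\<exists>u\<in>pverts G. y u \<noteq> 0"
    using eigenvalue_max_eigenvalue eigenvalue_adj_matrix_iff by blast
  define x where "x u = \<bar>y u\<bar>" for u
  have "?m * (\<Sum>u\<in>pverts G. x u * x u) = (\<Sum>u\<in>pverts G. y u * (\<Sum>v\<in>parcs G `` {u}. y v))"
    using y(1) by (simp add: eigenfunction_def x_def sum_distrib_left mult_ac)
  also have "\<dots> \<le> (\<Sum>u\<in>pverts G. x u * (\<Sum>v\<in>parcs G `` {u}. x v))"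
    unfolding sum_distrib_left x_def abs_mult[symmetric] by (intro sum_mono) simp
  finally have x: "eigenfunction G ?m x" by (rule rayleigh_maximizer_eigenfunction)
  have zero_nb: "x v = 0" if "(u, v) \<in> parcs G" "x u = 0" for u v
  proof -
    have "u \<in> pverts G" using that(1) by (auto dest: in_arcsD1)
    then have "(\<Sum>v\<in>parcs G `` {u}. x v) = 0" using x that(2) by (simp add: eigenfunction_def)
    then show ?thesis
      using that(1) finite_nbs[of u] by (subst (asm) sum_nonneg_eq_0_iff) (auto simp: x_def)
  qed
  have "x u > 0" if u: "u \<in> pverts G" for u
  proof (rule ccontr)
    assume "\<not> x u > 0"
    then have "x u = 0" by (simp add: x_def)
    have "x v = 0" if "v \<in> pverts G" for v
      using connected_reachable[OF conn u that]
      by (induction rule: reachable_induct) (use \<open>x u = 0\<close> zero_nb in auto)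
    then show False using y(2) by (auto simp: x_def)
  qed
  with x show ?thesis by (rule that)
qed

text \<open>The weights \<open>x a * x b\<close> turn the eigenvalue equation for \<open>y\<close> into the vanishing of the
  Dirichlet energy of \<open>y / x\<close>.\<close>

lemma (in pair_graph) eigenfunction_ratio_constant:
  assumes x: "eigenfunction G e x" "\<And>u. u \<in> pverts G \<Longrightarrow> x u > 0"
    and y: "eigenfunction G e y" and ab: "(a, b) \<in> parcs G"
  shows "y a / x a = y b / x b"
proof -
  define z where "z u = y u / x u" for u
  have yz: "y u = x u * z u" if "u \<in> pverts G" for u
    using x(2)[OF that] by (simp add: z_def)
  let ?D = "\<lambda>u v. x u * x v * (z u - z v)\<^sup>2"
  let ?s = "\<lambda>f. \<Sum>u\<in>pverts G. \<Sum>v\<in>parcs G `` {u}. f u v"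
  have "?s (\<lambda>u v. x u * x v * (z u)\<^sup>2) = (\<Sum>u\<in>pverts G. x u * (z u)\<^sup>2 * (\<Sum>v\<in>parcs G `` {u}. x v))"
    by (simp add: sum_distrib_left mult_ac)
  also have "\<dots> = (\<Sum>u\<in>pverts G. e * (y u)\<^sup>2)"
    using x(1) by (intro sum.cong refl) (simp add: eigenfunction_def yz power2_eq_square)
  finally have s1: "?s (\<lambda>u v. x u * x v * (z u)\<^sup>2) = (\<Sum>u\<in>pverts G. e * (y u)\<^sup>2)" .
  have s2: "?s (\<lambda>u v. x u * x v * (z v)\<^sup>2) = (\<Sum>u\<in>pverts G. e * (y u)\<^sup>2)"
    unfolding s1[symmetric] sum_nbs_swap[of "\<lambda>u v. x u * x v * (z v)\<^sup>2"]
    by (intro sum.cong refl) simp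
  have "?s (\<lambda>u v. y u * y v) = (\<Sum>u\<in>pverts G. y u * (\<Sum>v\<in>parcs G `` {u}. y v))"
    by (simp add: sum_distrib_left)
  also have "\<dots> = (\<Sum>u\<in>pverts G. e * (y u)\<^sup>2)"
    using y by (intro sum.cong refl) (simp add: eigenfunction_def power2_eq_square)
  finally have s3: "?s (\<lambda>u v. y u * y v) = (\<Sum>u\<in>pverts G. e * (y u)\<^sup>2)" .
  have s4: "?s (\<lambda>u v. 2 * (y u * y v)) = 2 * ?s (\<lambda>u v. y u * y v)"
    by (simp only: sum_distrib_left)
  \<comment> \<open>After expanding the square, the eigenvalue equation of \<open>x\<close>
    evaluates the first two sums and that of \<open>y\<close> the third. All three equal the sum of
    \<open>e * (y u)\<^sup>2\<close>, with coefficients 1, 1 and -2.\<close>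
  have "?s ?D = ?s (\<lambda>u v. x u * x v * (z u)\<^sup>2 + x u * x v * (z v)\<^sup>2 - 2 * (y u * y v))"
    by (intro sum.cong refl) (use nbs_subset in \<open>auto simp: yz power2_eq_square algebra_simps dest: in_arcsD2\<close>)
  also have "\<dots> = 0"
    unfolding sum_subtractf sum.distrib s1 s2 s4 s3 by simp
  finally have "?s ?D = 0" .
  moreover have nonneg: "?D u v \<ge> 0" if "u \<in> pverts G" "v \<in> parcs G `` {u}" for u v
    using x(2)[of u] x(2)[of v] that nbs_subset[of u] by (auto simp: less_imp_le)
  moreover have a: "a \<in> pverts G" "b \<in> pverts G" using ab by (auto dest: in_arcsD1 in_arcsD2)
  moreover have "(\<Sum>v\<in>parcs G `` {u}. ?D u v) \<ge> 0" if "u \<in> pverts G" for u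
    using nonneg[OF that] by (rule sum_nonneg)
  ultimately have "(\<Sum>v\<in>parcs G `` {a}. ?D a v) = 0"
    using sum_nonneg_eq_0_iff[OF pair_finite_verts, of "\<lambda>u. \<Sum>v\<in>parcs G `` {u}. ?D u v"]
    by blast
  then have "?D a b = 0"
    using sum_nonneg_eq_0_iff[OF finite_nbs, of a "?D a"] nonneg[OF a(1)] ab by auto
  then show ?thesis using x(2)[OF a(1)] x(2)[OF a(2)] by (simp add: z_def)
qed

text \<open>Every eigenfunction for the maximum has a constant ratio to the Perron eigenfunction
  along arcs, hence everywhere by connectedness, so its value at one vertex determines it.\<close>

lemma (in pair_graph) count_max_eigenvalue:
  assumes conn: "Digraph_Component.connected (with_proj G)"
  shows "count (adj_spectrum G) (max_eigenvalue G) = 1"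
proof -
  let ?m = "max_eigenvalue G"
  obtain v0 where v0: "v0 \<in> pverts G" using conn by (auto simp: connected_conv)
  obtain x where x: "eigenfunction G ?m x" "\<And>u. u \<in> pverts G \<Longrightarrow> x u > 0"
    using perron_eigenfunction[OF conn] by blast
  have "count (adj_spectrum G) ?m \<le> card {v0}"
  proof (rule count_adj_spectrum_le_card)
    fix f u assume f: "eigenfunction G ?m f" "\<And>s. s \<in> {v0} \<Longrightarrow> f s = 0" and u: "u \<in> pverts G"
    have "f u / x u = f v0 / x v0"
      using connected_reachable[OF conn v0 u]
    proof (induction rule: reachable_induct)
      case (step a b)
      then show ?case using eigenfunction_ratio_constant[OF x f(1), of a b] by simp
    qed simp
    then show "f u = 0" using f(2) x(2)[OF u] by simp
  qed (use v0 in auto)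
  moreover have "?m \<in># adj_spectrum G"
    using eigenvalue_max_eigenvalue v0 by (auto simp: set_adj_spectrum)
  then have "count (adj_spectrum G) ?m > 0" by simp
  moreover have "card {v0} = 1" by simp
  ultimately show ?thesis by linarith
qed

section \<open>The cover graph\<close>

lemma digraph_isoI:
  assumes "pair_graph \<Gamma>" "inj_on \<phi> (pverts \<Gamma>)" "pverts \<Delta> = \<phi> ` pverts \<Gamma>"
    "parcs \<Delta> = map_prod \<phi> \<phi> ` parcs \<Gamma>"
  shows "digraph_iso (with_proj \<Gamma>) (with_proj \<Delta>)"
proof -
  interpret pair_graph \<Gamma> by fact
  let ?h = "\<lparr>iso_verts = \<phi>, iso_arcs = map_prod \<phi> \<phi>, iso_head = snd, iso_tail = fst\<rparr>"
  have "parcs \<Gamma> \<subseteq> pverts \<Gamma> \<times> pverts \<Gamma>" by (auto dest: in_arcsD1 in_arcsD2)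
  then have "inj_on (map_prod \<phi> \<phi>) (parcs \<Gamma>)"
    using map_prod_inj_on[OF assms(2,2)] inj_on_subset by blast
  then have "digraph_isomorphism ?h"
    using assms(2) wf_digraph_axioms by (simp add: digraph_isomorphism_def)
  moreover have "with_proj \<Delta> = app_iso ?h (with_proj \<Gamma>)"
    using assms(3,4) by (simp add: app_iso_def with_proj_def)
  ultimately show ?thesis by (auto simp: digraph_iso_def)
qed

text \<open>An abstract digraph isomorphism brings its own arc map and its own head and tail
  functions. Since both graphs use \<open>fst\<close> and \<open>snd\<close> as tail and head, the
  arc map must be the one induced by the vertex map.\<close>

lemma digraph_iso_pair_graphE:
  assumes "pair_graph \<Gamma>" "digraph_iso (with_proj \<Gamma>) (with_proj \<Delta>)"
  obtains \<phi> where "inj_on \<phi> (pverts \<Gamma>)" "pverts \<Delta> = \<phi> ` pverts \<Gamma>"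
    "\<And>u v. u \<in> pverts \<Gamma> \<Longrightarrow> v \<in> pverts \<Gamma> \<Longrightarrow> (\<phi> u, \<phi> v) \<in> parcs \<Delta> \<longleftrightarrow> (u, v) \<in> parcs \<Gamma>"
proof -
  interpret pair_graph \<Gamma> by fact
  obtain h where h: "digraph_isomorphism h" and eq: "with_proj \<Delta> = app_iso h (with_proj \<Gamma>)"
    using assms(2) by (auto simp: digraph_iso_def)
  let ?\<phi> = "iso_verts h"
  have tl: "iso_tail h = fst" "iso_head h = snd"
    using arg_cong[OF eq, of tail] arg_cong[OF eq, of head] by auto
  have arcs: "parcs \<Delta> = iso_arcs h ` parcs \<Gamma>" and verts: "pverts \<Delta> = ?\<phi> ` pverts \<Gamma>"
    using arg_cong[OF eq, of arcs] arg_cong[OF eq, of verts] by auto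
  have inj: "inj_on ?\<phi> (pverts \<Gamma>)" using h by (simp add: digraph_isomorphism_def)
  have "iso_arcs h a = map_prod ?\<phi> ?\<phi> a" if "a \<in> parcs \<Gamma>" for a
    using iso_verts_tail[OF h, of a] iso_verts_head[OF h, of a] that tl by (auto simp: prod_eq_iff)
  then have "parcs \<Delta> = map_prod ?\<phi> ?\<phi> ` parcs \<Gamma>" unfolding arcs by (rule image_cong[OF refl])
  then have "(?\<phi> u, ?\<phi> v) \<in> parcs \<Delta> \<longleftrightarrow> (u, v) \<in> parcs \<Gamma>" if uv: "u \<in> pverts \<Gamma>" "v \<in> pverts \<Gamma>" for u v
    using inj uv by (auto simp: image_iff dest: in_arcsD1 in_arcsD2 inj_onD intro: rev_bexI)
      (metis in_arcsD1 in_arcsD2 inj_onD)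
  with inj verts show ?thesis by (rule that)
qed

text \<open>Carrying a vertex ordering along the isomorphism yields literally the same
  matrix.\<close>

lemma adj_spectrum_digraph_iso:
  assumes "pair_graph \<Gamma>" "digraph_iso (with_proj \<Gamma>) (with_proj \<Delta>)"
  shows "adj_spectrum \<Gamma> = adj_spectrum \<Delta>"
proof -
  obtain \<phi> where \<phi>: "inj_on \<phi> (pverts \<Gamma>)" "pverts \<Delta> = \<phi> ` pverts \<Gamma>"
    "\<And>u v. u \<in> pverts \<Gamma> \<Longrightarrow> v \<in> pverts \<Gamma> \<Longrightarrow> (\<phi> u, \<phi> v) \<in> parcs \<Delta> \<longleftrightarrow> (u, v) \<in> parcs \<Gamma>"
    using digraph_iso_pair_graphE[OF assms] by blast
  obtain vs where vs: "distinct vs" "set vs = pverts \<Gamma>" "adj_matrix \<Gamma> = adj_matrix_of vs \<Gamma>"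
    using obtain_vertex_ordering[OF assms(1)] .
  have "adj_matrix_of vs \<Gamma> = adj_matrix_of (map \<phi> vs) \<Delta>"
    unfolding adj_matrix_of_def using \<phi>(3) vs(2)
    by (intro cong_mat) (auto simp: set_conv_nth)
  moreover have "char_poly (adj_matrix \<Delta>) = char_poly (adj_matrix_of (map \<phi> vs) \<Delta>)"
    using \<phi>(1,2) vs(1,2) by (intro char_poly_adj_matrix) (auto simp: distinct_map)
  ultimately show ?thesis by (simp add: adj_spectrum_def vs(3))
qed

section \<open>Spectrum of a disjoint union of copies\<close>

lemma char_poly_block_diag:
  fixes A B :: "'a :: idom mat"
  assumes A: "A \<in> carrier_mat n n" and B: "B \<in> carrier_mat m m"
  shows "char_poly (four_block_mat A (0\<^sub>m n m) (0\<^sub>m m n) B) = char_poly A * char_poly B"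
proof -
  have "char_poly_matrix (four_block_mat A (0\<^sub>m n m) (0\<^sub>m m n) B) =
      four_block_mat (char_poly_matrix A) (0\<^sub>m n m) (0\<^sub>m m n) (char_poly_matrix B)"
    using A B by (intro eq_matI) (auto simp: char_poly_matrix_def)
  then show ?thesis
    unfolding char_poly_def
    using det_four_block_mat_upper_right_zero[of "char_poly_matrix A" n "0\<^sub>m n m" m "0\<^sub>m m n" "char_poly_matrix B"] A B
    by simp
qed

lemma adj_matrix_of_append:
  assumes "\<And>x y. x \<in> set xs \<Longrightarrow> y \<in> set ys \<Longrightarrow> (x, y) \<notin> parcs \<Gamma> \<and> (y, x) \<notin> parcs \<Gamma>"
  shows "adj_matrix_of (xs @ ys) \<Gamma> = four_block_mat (adj_matrix_of xs \<Gamma>)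
    (0\<^sub>m (length xs) (length ys)) (0\<^sub>m (length ys) (length xs)) (adj_matrix_of ys \<Gamma>)"
  by (rule eq_matI) (use assms in \<open>auto simp: adj_matrix_of_def nth_append\<close>)

text \<open>Listing the vertices copy by copy makes the adjacency matrix block diagonal. The
  induction keeps the graph fixed and lengthens the list: \<open>adj_matrix_of\<close> applied to
  \<open>ws j\<close> is the matrix of the subgraph induced on the first \<open>j\<close>
  copies.\<close>

lemma char_poly_disjoint_copies:
  assumes "distinct vs" "set vs = pverts \<Gamma>"
  shows "char_poly (adj_matrix (disjoint_copies k \<Gamma>)) = char_poly (adj_matrix_of vs \<Gamma>) ^ k"
proof -
  let ?D = "disjoint_copies k \<Gamma>"
  define ws where "ws j = concat (map (\<lambda>i. map (Pair i) vs) [0..<j])" for j :: nat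
  have ws: "ws 0 = []" "ws (Suc j) = ws j @ map (Pair j) vs" for j
    by (simp_all add: ws_def)
  have set_ws: "set (ws j) = {..<j} \<times> pverts \<Gamma>" for j
  proof (induction j)
    case (Suc j)
    show ?case
      unfolding ws(2) set_append set_map assms(2) lessThan_Suc Suc.IH by blast
  qed (simp add: ws)
  have "distinct (ws j)" for j
  proof (induction j)
    case (Suc j)
    moreover have "distinct (map (Pair j) vs)" using assms(1) by (simp add: distinct_map inj_on_def)
    ultimately show ?case unfolding ws(2) distinct_append set_ws by auto
  qed (simp add: ws)
  have "char_poly (adj_matrix_of (ws j) ?D) = char_poly (adj_matrix_of vs \<Gamma>) ^ j" if "j \<le> k" for j
    using that
  proof (induction j)
    case 0
    then show ?case by (simp add: ws adj_matrix_of_def char_poly_def)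
  next
    case (Suc j)
    have "adj_matrix_of (map (Pair j) vs) ?D = adj_matrix_of vs \<Gamma>"
      unfolding adj_matrix_of_def using Suc.prems
      by (intro cong_mat) (auto simp: disjoint_copies_def)
    moreover have "adj_matrix_of (ws (Suc j)) ?D = four_block_mat (adj_matrix_of (ws j) ?D)
        (0\<^sub>m (length (ws j)) (length (map (Pair j) vs))) (0\<^sub>m (length (map (Pair j) vs)) (length (ws j)))
        (adj_matrix_of (map (Pair j) vs) ?D)"
      unfolding ws(2) by (rule adj_matrix_of_append) (auto simp: set_ws disjoint_copies_def)
    ultimately show ?case
      using Suc by (simp add: char_poly_block_diag[OF adj_matrix_of_carrier adj_matrix_of_carrier])
  qed
  moreover have "char_poly (adj_matrix ?D) = char_poly (adj_matrix_of (ws k) ?D)"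
    using \<open>distinct (ws k)\<close> by (intro char_poly_adj_matrix) (auto simp: set_ws disjoint_copies_def)
  ultimately show ?thesis by simp
qed

lemma adj_spectrum_disjoint_copies:
  assumes "pair_graph \<Gamma>"
  shows "adj_spectrum (disjoint_copies k \<Gamma>) = repeat_mset k (adj_spectrum \<Gamma>)"
proof -
  obtain vs where vs: "distinct vs" "set vs = pverts \<Gamma>" "adj_matrix \<Gamma> = adj_matrix_of vs \<Gamma>"
    using obtain_vertex_ordering[OF assms] .
  show ?thesis
    by (simp add: adj_spectrum_def char_poly_disjoint_copies[OF vs(1,2)] vs(3) proots_power)
qed

section \<open>Finite gain graphs, walks and their lifts to the cover\<close>

locale finite_gain_graph = group G + base: pair_graph \<Gamma>
  for G :: "('g, 'm) monoid_scheme" (structure) and \<Gamma> :: "'v pair_pre_digraph" +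
  fixes \<Psi> :: "'v \<times> 'v \<Rightarrow> 'g"
  assumes finite_carrier: "finite (carrier G)"
    and conn: "Digraph_Component.connected (with_proj \<Gamma>)"
    and gain: "gain_function G \<Gamma> \<Psi>"
begin

abbreviation "L \<equiv> cover_graph G \<Gamma> \<Psi>"

sublocale cover: pair_graph L
  using pair_graph_cover_graph[OF group_axioms finite_carrier base.pair_graph_axioms gain] .

lemma pverts_cover: "pverts L = pverts \<Gamma> \<times> carrier G"
  by (simp add: cover_graph_def)

lemma gain_closed: "(u, v) \<in> parcs \<Gamma> \<Longrightarrow> \<Psi> (u, v) \<in> carrier G"
  using gain by (fastforce simp: gain_function_def)

lemma cover_nbs:
  assumes "g \<in> carrier G"
  shows "parcs L `` {(u, g)} = (\<lambda>v. (v, inv \<Psi> (u, v) \<otimes> g)) ` (parcs \<Gamma> `` {u})"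
  using assms gain_closed by (auto simp: cover_graph_def)

lemma walk_gain_Cons: "walk_gain G \<Psi> (u # v # p) = \<Psi> (u, v) \<otimes> walk_gain G \<Psi> (v # p)"
  by (simp add: walk_gain_def)

lemma walk_induct [consumes 1, case_names single step]:
  assumes "vwalk p (with_proj \<Gamma>)" "\<And>u. u \<in> pverts \<Gamma> \<Longrightarrow> P [u]"
    "\<And>u v p. (u, v) \<in> parcs \<Gamma> \<Longrightarrow> vwalk (v # p) (with_proj \<Gamma>) \<Longrightarrow> P (v # p) \<Longrightarrow> P (u # v # p)"
  shows "P p"
  using assms(1)
proof (induction p rule: list.induct)
  case (Cons u p)
  show ?case
  proof (cases p)
    case Nil
    then show ?thesis using Cons.prems assms(2) by (auto simp: vwalk_def)
  next
    case (Cons v q)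
    then have "(u, v) \<in> parcs \<Gamma>" "vwalk (v # q) (with_proj \<Gamma>)"
      using Cons.prems by (auto simp: vwalk_def)
    then show ?thesis using Cons.IH assms(3) Cons by blast
  qed
qed (simp add: vwalk_def)

lemma walk_gain_closed: "vwalk p (with_proj \<Gamma>) \<Longrightarrow> walk_gain G \<Psi> p \<in> carrier G"
proof (induction p rule: walk_induct)
  case (step u v p)
  then show ?case using gain_closed[of u v] by (simp add: walk_gain_Cons)
qed (simp add: walk_gain_def)

lemma walk_gain_join:
  assumes "vwalk p (with_proj \<Gamma>)" "vwalk q (with_proj \<Gamma>)" "last p = hd q"
  shows "walk_gain G \<Psi> (p \<oplus> q) = walk_gain G \<Psi> p \<otimes> walk_gain G \<Psi> q"
  using assms(1,3)
proof (induction p rule: walk_induct)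
  case (single u)
  have "q \<noteq> []" using assms(2) by (simp add: vwalk_def)
  with single(2) have "[u] \<oplus> q = q" by (simp add: vwalk_join_def)
  then show ?case using walk_gain_closed[OF assms(2)] by (simp add: walk_gain_def)
next
  case (step u v p)
  then show ?case
    using gain_closed[of u v] walk_gain_closed[OF assms(2)] walk_gain_closed[of "v # p"]
    by (cases p) (auto simp: walk_gain_Cons m_assoc vwalk_join_def)
qed

text \<open>The walk \<open>p\<close> lifts to a walk in the cover starting at
  \<open>(hd p, g)\<close>. Each arc multiplies the group component on the left by an inverse gain,
  so the inverse of the whole gain accumulates, and \<open>z\<close> is constant along the
  lift.\<close>

lemma cover_walk_invariant:
  assumes z: "\<And>a b. (a, b) \<in> parcs L \<Longrightarrow> z a = z b"
    and "vwalk p (with_proj \<Gamma>)" "g \<in> carrier G"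
  shows "z (hd p, g) = z (last p, inv (walk_gain G \<Psi> p) \<otimes> g)"
  using assms(2,3)
proof (induction p arbitrary: g rule: walk_induct)
  case (single u)
  then show ?case by (simp add: walk_gain_def)
next
  case (step u v p)
  have c: "\<Psi> (u, v) \<in> carrier G" "walk_gain G \<Psi> (v # p) \<in> carrier G"
    using step gain_closed walk_gain_closed by auto
  have "z (u, g) = z (v, inv \<Psi> (u, v) \<otimes> g)"
    using step c by (intro z) (auto simp: cover_graph_def)
  also have "\<dots> = z (last (v # p), inv (walk_gain G \<Psi> (v # p)) \<otimes> (inv \<Psi> (u, v) \<otimes> g))"
    using step.IH[of "inv \<Psi> (u, v) \<otimes> g"] step.prems c by simp
  finally show ?case
    using c step.prems by (simp add: walk_gain_Cons inv_mult_group m_assoc)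
qed

lemma obtain_walk:
  assumes "u \<in> pverts \<Gamma>" "v \<in> pverts \<Gamma>"
  obtains p where "vwalk p (with_proj \<Gamma>)" "hd p = u" "last p = v"
  using base.connected_reachable[OF conn assms] base.reachable_vwalk_conv by blast

text \<open>The projection to \<Gamma> maps the neighbours of \<open>(u, g)\<close> bijectively to
  those of \<open>u\<close>, so the neighbour sums agree.\<close>

lemma eigenfunction_lift:
  assumes "eigenfunction \<Gamma> e x"
  shows "eigenfunction L e (x \<circ> fst)"
  unfolding eigenfunction_def
proof
  fix a assume "a \<in> pverts L"
  then obtain u g where a: "a = (u, g)" "u \<in> pverts \<Gamma>" "g \<in> carrier G"
    by (auto simp: pverts_cover)
  have "(\<Sum>b\<in>parcs L `` {a}. (x \<circ> fst) b) = (\<Sum>v\<in>parcs \<Gamma> `` {u}. x v)"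
    unfolding a(1) cover_nbs[OF a(3)] by (subst sum.reindex) (auto simp: inj_on_def)
  then show "(\<Sum>b\<in>parcs L `` {a}. (x \<circ> fst) b) = e * (x \<circ> fst) a"
    using assms a by (simp add: eigenfunction_def)
qed

section \<open>Balanced gain functions: potentials and the splitting of the cover\<close>

lemma balanced_walk_gain_unique:
  assumes bal: "balanced G \<Gamma> \<Psi>" and p: "vwalk p (with_proj \<Gamma>)" and q: "vwalk q (with_proj \<Gamma>)"
    and ends: "hd p = hd q" "last p = last q"
  shows "walk_gain G \<Psi> p = walk_gain G \<Psi> q"
proof -
  have "hd p \<in> pverts \<Gamma>" "last p \<in> pverts \<Gamma>"
    using p by (auto simp: vwalk_def)
  \<comment> \<open>One return walk \<open>r\<close> closes both \<open>p\<close> and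
    \<open>q\<close>. By balance both products with the gain of \<open>r\<close> are the identity,
    and that gain can be cancelled.\<close>
  then obtain r where r: "vwalk r (with_proj \<Gamma>)" "hd r = last p" "last r = hd p"
    using obtain_walk by metis
  have "walk_gain G \<Psi> w \<otimes> walk_gain G \<Psi> r = \<one>"
    if w: "vwalk w (with_proj \<Gamma>)" "hd w = hd p" "last w = last p" for w
  proof -
    have join: "joinable w r" using w r by (simp add: joinable_def vwalk_def)
    have "vwalk (w \<oplus> r) (with_proj \<Gamma>)" using w r by (intro vwalk_joinI_vwalk') auto
    moreover have "hd (w \<oplus> r) = last (w \<oplus> r)"
      unfolding vwalk_join_hd[OF join] vwalk_join_last[OF join] using w r by simp
    ultimately show ?thesis
      using bal walk_gain_join[of w r] w r by (simp add: balanced_def)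
  qed
  from this[of p] this[of q] show ?thesis
    using p q ends walk_gain_closed r(1) by (metis right_cancel)
qed

text \<open>\<open>f u\<close> is the gain of a chosen walk from \<open>u\<close> to a fixed base
  vertex. Prefixing the arc \<open>(u, v)\<close> to the walk of \<open>v\<close> gives another walk
  from \<open>u\<close> to the base vertex, which has the same gain by balance.\<close>

lemma balanced_potential:
  assumes bal: "balanced G \<Gamma> \<Psi>"
  obtains f where "\<And>u. u \<in> pverts \<Gamma> \<Longrightarrow> f u \<in> carrier G"
    "\<And>u v. (u, v) \<in> parcs \<Gamma> \<Longrightarrow> f u = \<Psi> (u, v) \<otimes> f v"
proof -
  obtain v0 where v0: "v0 \<in> pverts \<Gamma>" using conn by (auto simp: connected_conv)
  have "\<forall>u\<in>pverts \<Gamma>. \<exists>p. vwalk p (with_proj \<Gamma>) \<and> hd p = u \<and> last p = v0"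
    using obtain_walk[OF _ v0] by metis
  then obtain w where w: "\<And>u. u \<in> pverts \<Gamma> \<Longrightarrow> vwalk (w u) (with_proj \<Gamma>) \<and> hd (w u) = u \<and> last (w u) = v0"
    by metis
  show ?thesis
  proof (rule that[of "\<lambda>u. walk_gain G \<Psi> (w u)"])
    fix u v assume uv: "(u, v) \<in> parcs \<Gamma>"
    then have V: "u \<in> pverts \<Gamma>" "v \<in> pverts \<Gamma>"
      by (auto dest: base.in_arcsD1 base.in_arcsD2)
    obtain p where p: "w v = v # p"
      using w[OF V(2)] by (metis list.exhaust_sel vwalk_def)
    have "vwalk (u # v # p) (with_proj \<Gamma>)"
      using w[OF V(2)] uv V(1) unfolding p by (auto simp: vwalk_def)
    then have "walk_gain G \<Psi> (w u) = walk_gain G \<Psi> (u # v # p)"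
      using w[OF V(1)] w[OF V(2)] p by (intro balanced_walk_gain_unique[OF bal]) auto
    then show "walk_gain G \<Psi> (w u) = \<Psi> (u, v) \<otimes> walk_gain G \<Psi> (w v)"
      by (simp add: walk_gain_Cons p)
  qed (use w walk_gain_closed in blast)
qed

text \<open>A potential \<open>f\<close> makes \<open>inv (f u) \<otimes> g\<close> invariant along the arcs of the cover, so it labels the
  sheets.\<close>

lemma balanced_cover_iso:
  assumes "balanced G \<Gamma> \<Psi>"
  shows "digraph_iso (with_proj L) (with_proj (disjoint_copies (Coset.order G) \<Gamma>))"
proof -
  obtain f where f: "\<And>u. u \<in> pverts \<Gamma> \<Longrightarrow> f u \<in> carrier G"
    "\<And>u v. (u, v) \<in> parcs \<Gamma> \<Longrightarrow> f u = \<Psi> (u, v) \<otimes> f v"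
    using balanced_potential[OF assms] by blast
  obtain \<beta> where \<beta>: "bij_betw \<beta> (carrier G) {0..<Coset.order G}"
    using ex_bij_betw_finite_nat[OF finite_carrier] by (auto simp: Coset.order_def)
  define s where "s u g = inv (f u) \<otimes> g" for u g
  \<comment> \<open>\<beta> numbers the sheets. For a fixed vertex \<open>u\<close>, the map
    \<open>s u\<close> permutes the carrier, with left multiplication by \<open>f u\<close> as
    inverse, so each fibre meets every sheet exactly once.\<close>
  define \<phi> where "\<phi> = (\<lambda>(u, g). (\<beta> (s u g), u))"
  have s_closed: "s u g \<in> carrier G" if "u \<in> pverts \<Gamma>" "g \<in> carrier G" for u g
    using f(1) that by (simp add: s_def)
  have s_inv: "s u (f u \<otimes> g) = g" "f u \<otimes> s u g = g" if "u \<in> pverts \<Gamma>" "g \<in> carrier G" for u g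
    using f(1)[OF that(1)] that(2) by (simp_all add: s_def m_assoc[symmetric])
  have s_arc: "s v (inv \<Psi> (u, v) \<otimes> g) = s u g" if uv: "(u, v) \<in> parcs \<Gamma>" and g: "g \<in> carrier G" for u v g
  proof -
    have "f v \<in> carrier G" using f(1) uv by (auto dest: base.in_arcsD2)
    then show ?thesis
      using gain_closed[OF uv] g by (simp add: s_def f(2)[OF uv] inv_mult_group m_assoc)
  qed
  have \<beta>_ex: "\<exists>g\<in>carrier G. \<beta> (s u g) = i" if "u \<in> pverts \<Gamma>" "i < Coset.order G" for u i
  proof -
    have "i \<in> \<beta> ` carrier G" using \<beta> that(2) by (simp add: bij_betw_def)
    then obtain h where "h \<in> carrier G" "\<beta> h = i" by blast
    then show ?thesis using s_inv(1)[OF that(1)] f(1)[OF that(1)] by (intro bexI[of _ "f u \<otimes> h"]) auto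
  qed
  have \<beta>_less: "\<beta> (s u g) < Coset.order G" if "u \<in> pverts \<Gamma>" "g \<in> carrier G" for u g
    using bij_betwE[OF \<beta>] s_closed[OF that] by auto
  show ?thesis
  proof (rule digraph_isoI[OF cover.pair_graph_axioms, of \<phi>])
    show "inj_on \<phi> (pverts L)"
    proof (rule inj_onI)
      fix a b assume ab: "a \<in> pverts L" "b \<in> pverts L" and eq: "\<phi> a = \<phi> b"
      then obtain u g h where a: "a = (u, g)" "b = (u, h)" "u \<in> pverts \<Gamma>" "g \<in> carrier G" "h \<in> carrier G"
        by (auto simp: pverts_cover \<phi>_def)
      then have "s u g = s u h"
        using eq \<beta> s_closed by (auto simp: \<phi>_def bij_betw_def dest: inj_onD)
      then show "a = b" using s_inv(2) a by metis
    qed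
    show "pverts (disjoint_copies (Coset.order G) \<Gamma>) = \<phi> ` pverts L"
    proof (rule Set.set_eqI, rule iffI)
      fix c assume "c \<in> pverts (disjoint_copies (Coset.order G) \<Gamma>)"
      then obtain i u where c: "c = (i, u)" "i < Coset.order G" "u \<in> pverts \<Gamma>"
        by (auto simp: disjoint_copies_def)
      then show "c \<in> \<phi> ` pverts L"
        using \<beta>_ex[OF c(3,2)] by (force simp: \<phi>_def pverts_cover)
    qed (auto simp: \<phi>_def pverts_cover disjoint_copies_def \<beta>_less)
    show "parcs (disjoint_copies (Coset.order G) \<Gamma>) = map_prod \<phi> \<phi> ` parcs L"
    proof (rule Set.set_eqI, rule iffI)
      fix c assume "c \<in> parcs (disjoint_copies (Coset.order G) \<Gamma>)"
      then obtain i u v where c: "c = ((i, u), (i, v))" "i < Coset.order G" "(u, v) \<in> parcs \<Gamma>"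
        by (auto simp: disjoint_copies_def)
      then have "u \<in> pverts \<Gamma>" by (auto dest: base.in_arcsD1)
      then obtain g where g: "g \<in> carrier G" "\<beta> (s u g) = i" using \<beta>_ex c(2) by blast
      have "((u, g), (v, inv \<Psi> (u, v) \<otimes> g)) \<in> parcs L"
        using c(3) g(1) gain_closed[OF c(3)] by (auto simp: cover_graph_def)
      moreover have "c = map_prod \<phi> \<phi> ((u, g), (v, inv \<Psi> (u, v) \<otimes> g))"
        using s_arc[OF c(3) g(1)] g(2) c(1) by (simp add: \<phi>_def)
      ultimately show "c \<in> map_prod \<phi> \<phi> ` parcs L" by blast
    next
      fix c assume "c \<in> map_prod \<phi> \<phi> ` parcs L"
      then obtain u g v where uv: "(u, v) \<in> parcs \<Gamma>" "g \<in> carrier G"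
        "c = map_prod \<phi> \<phi> ((u, g), (v, inv \<Psi> (u, v) \<otimes> g))"
        by (auto simp: cover_graph_def)
      have "u \<in> pverts \<Gamma>" using uv(1) by (auto dest: base.in_arcsD1)
      then show "c \<in> parcs (disjoint_copies (Coset.order G) \<Gamma>)"
        using uv s_arc[OF uv(1,2)] \<beta>_less by (auto simp: \<phi>_def disjoint_copies_def)
    qed
  qed
qed

text \<open>The eigenvalue is taken from \<Gamma>, so that the lifted Perron eigenfunction of
  \<Gamma> serves as the positive comparison function on the cover.\<close>

lemma balanced_if_full_multiplicity:
  assumes count: "count (adj_spectrum L) (max_eigenvalue \<Gamma>) = Coset.order G"
  shows "balanced G \<Gamma> \<Psi>"
proof (rule ccontr)
  let ?m = "max_eigenvalue \<Gamma>"
  assume "\<not> balanced G \<Gamma> \<Psi>"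
  then obtain p where p: "vwalk p (with_proj \<Gamma>)" "hd p = last p" "walk_gain G \<Psi> p \<noteq> \<one>"
    by (auto simp: balanced_def)
  let ?v = "hd p" and ?g = "walk_gain G \<Psi> p"
  have v: "?v \<in> pverts \<Gamma>" using p(1) by (auto simp: vwalk_def)
  have g: "?g \<in> carrier G" using walk_gain_closed[OF p(1)] .
  obtain x where x: "eigenfunction \<Gamma> ?m x" "\<And>u. u \<in> pverts \<Gamma> \<Longrightarrow> x u > 0"
    using base.perron_eigenfunction[OF conn] by blast
  \<comment> \<open>The point \<open>(?v, \<one>)\<close> may be left out of the fibre: lifting
    \<open>p\<close> from it ends at \<open>(?v, inv ?g)\<close>, which lies in \<open>S\<close>
    because \<open>?g\<close> is not the identity, and the ratio \<open>z\<close> takes the same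
    value at both.\<close>
  define S where "S = {?v} \<times> (carrier G - {\<one>})"
  have "count (adj_spectrum L) ?m \<le> card S"
  proof (rule cover.count_adj_spectrum_le_card)
    fix f a assume f: "eigenfunction L ?m f" "\<And>s. s \<in> S \<Longrightarrow> f s = 0" and a: "a \<in> pverts L"
    define z where "z b = f b / (x \<circ> fst) b" for b
    have z: "z b = z c" if "(b, c) \<in> parcs L" for b c
      unfolding z_def
      by (rule cover.eigenfunction_ratio_constant[OF eigenfunction_lift[OF x(1)] _ f(1) that])
        (auto simp: pverts_cover x(2))
    have zS: "z (?v, h) = 0" if "h \<in> carrier G" "h \<noteq> \<one>" for h
      using f(2) that by (simp add: z_def S_def)
    moreover have "z (?v, \<one>) = z (?v, inv ?g)"
      using cover_walk_invariant[where z = z, OF z p(1) one_closed] g p(2) by simp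
    moreover have "inv ?g \<noteq> \<one>" using g p(3) by simp
    ultimately have zv: "z (?v, h) = 0" if "h \<in> carrier G" for h
      using that g by (cases "h = \<one>") auto
    obtain u h where uh: "a = (u, h)" "u \<in> pverts \<Gamma>" "h \<in> carrier G"
      using a by (auto simp: pverts_cover)
    \<comment> \<open>Lifting a walk from \<open>u\<close> to \<open>?v\<close> joins the arbitrary
      vertex \<open>a\<close> to the fibre over \<open>?v\<close>, where \<open>z\<close> is already
      known to vanish.\<close>
    obtain q where q: "vwalk q (with_proj \<Gamma>)" "hd q = u" "last q = ?v"
      using obtain_walk[OF uh(2) v] .
    have "z a = 0"
      using cover_walk_invariant[where z = z, OF z q(1) uh(3)] zv walk_gain_closed[OF q(1)] uh q by simp
    then show "f a = 0" using x(2)[OF uh(2)] uh(1) by (simp add: z_def)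
  qed (use v in \<open>auto simp: S_def pverts_cover\<close>)
  also have "card S < Coset.order G"
    unfolding S_def Coset.order_def card_cartesian_product_singleton
    by (rule card_Diff1_less[OF finite_carrier one_closed])
  finally show False using count by simp
qed

end

theorem theorem4:
  fixes G :: "('g, 'm) monoid_scheme" and k :: nat
    and \<Gamma> :: "'v pair_pre_digraph" and \<Psi> :: "'v \<times> 'v \<Rightarrow> 'g"
  assumes "group G" and "finite (carrier G)" and "Coset.order G = k"
    and "pair_graph \<Gamma>" and "Digraph_Component.connected (with_proj \<Gamma>)"
    and "gain_function G \<Gamma> \<Psi>"
  shows "(balanced G \<Gamma> \<Psi> \<longleftrightarrow>
            adj_spectrum (cover_graph G \<Gamma> \<Psi>) = repeat_mset k (adj_spectrum \<Gamma>)) \<and>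
         (balanced G \<Gamma> \<Psi> \<longleftrightarrow>
            max_eigenvalue (cover_graph G \<Gamma> \<Psi>) = max_eigenvalue \<Gamma> \<and>
            count (adj_spectrum (cover_graph G \<Gamma> \<Psi>)) (max_eigenvalue (cover_graph G \<Gamma> \<Psi>)) = k) \<and>
         (balanced G \<Gamma> \<Psi> \<longleftrightarrow>
            digraph_iso (with_proj (cover_graph G \<Gamma> \<Psi>)) (with_proj (disjoint_copies k \<Gamma>)))"
    (is "(?i \<longleftrightarrow> ?ii) \<and> (?i \<longleftrightarrow> ?iii) \<and> (?i \<longleftrightarrow> ?iv)")
proof -
  interpret finite_gain_graph G \<Gamma> \<Psi>
    using assms by (intro finite_gain_graph.intro finite_gain_graph_axioms.intro)
  have "k > 0" using assms(3) order_gt_0_iff_finite finite_carrier by blast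
  \<comment> \<open>The equivalences follow from the cycle \<open>?i\<close>, \<open>?iv\<close>,
    \<open>?ii\<close>, \<open>?iii\<close>, \<open>?i\<close> of implications.\<close>
  have "?iv" if "?i" using balanced_cover_iso[OF that] assms(3) by simp
  moreover have "?ii" if "?iv"
    using adj_spectrum_digraph_iso[OF cover.pair_graph_axioms that]
      adj_spectrum_disjoint_copies[OF assms(4)] by simp
  moreover have "?iii" if "?ii"
  proof -
    \<comment> \<open>Repeating a multiset a positive number of times keeps its set of elements,
      hence the maximum. The simplicity of the largest eigenvalue of \<Gamma> then makes the
      multiplicity exactly \<open>k\<close>.\<close>
    have "max_eigenvalue L = max_eigenvalue \<Gamma>"
      unfolding max_eigenvalue_spectrum that set_mset_def using \<open>k > 0\<close> by simp
    then show ?thesis using that base.count_max_eigenvalue[OF conn] by simp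
  qed
  moreover have "?i" if "?iii"
    using balanced_if_full_multiplicity that assms(3) by metis
  ultimately show ?thesis by blast
qed

end
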